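(* a) If $w \in A_{\infty}$, then for every cube $Q$ \begin{equation*} \Big(\frac{1}{|Q|}\int_Q w^{r(w)}\Big)^{1/r(w)}\leq 2\,\frac{1}{|Q|}\int_Q w. \end{equation*} b) Furthermore, the result is optimal up to a dimensional factor: If a weight $w$ satisfies the reverse H\"older inequality \begin{equation*} \Big(\frac{1}{|Q|}\int_Q w^r\Big)^{1/r}\leq K\,\frac{1}{|Q|}\int_Q w \end{equation*} for all cubes $Q$, then $[w]_{A_\infty}'\leq c_d \cdot K\cdot r'$.
   Context: Weights on $\mathbb{R}^d$. $[w]_{A_\infty}':=\sup_Q\frac{1}{w(Q)}\int_Q M(w\chi_Q)$ (supremum over cubes, $M$ the Hardy--Littlewood maximal operator), and $r(w):=1+\frac{1}{\tau_d\,[w]_{A_{\infty}}'}$ with $\tau_d=2^{11+d}$. $c_d$ is dimensional. *)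

theory Defs
  imports "HOL-Analysis.Analysis"
begin

definition cube :: "'a::euclidean_space set \<Rightarrow> bool" where
  "cube Q \<longleftrightarrow> (\<exists>x s. s > 0 \<and> Q = cbox x (x + s *\<^sub>R One))"

definition weight :: "('a::euclidean_space \<Rightarrow> real) \<Rightarrow> bool" where
  "weight w \<longleftrightarrow> w \<in> borel_measurable lebesgue \<and> (\<forall>x. 0 \<le> w x)
     \<and> (AE x in lebesgue. 0 < w x)
     \<and> (\<forall>a b. set_integrable lebesgue (cbox a b) w)"

definition maxfun :: "('a::euclidean_space \<Rightarrow> real) \<Rightarrow> 'a \<Rightarrow> ennreal" where
  "maxfun f x = (SUP Q\<in>{Q. cube Q \<and> x \<in> Q}.
      (\<integral>\<^sup>+ y\<in>Q. ennreal \<bar>f y\<bar> \<partial>lebesgue) / emeasure lebesgue Q)"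

definition Ainf :: "('a::euclidean_space \<Rightarrow> real) \<Rightarrow> ennreal" where
  "Ainf w = (SUP Q\<in>{Q. cube Q}.
      (\<integral>\<^sup>+ x\<in>Q. maxfun (\<lambda>y. w y * indicator Q y) x \<partial>lebesgue)
        / (\<integral>\<^sup>+ x\<in>Q. ennreal (w x) \<partial>lebesgue))"

end

theory Submission
  imports Defs
begin

text \<open>
  Part (a) follows the stopping time argument for the dyadic maximal function \<open>M\<close> of a cube \<open>Q\<close>,
  with the layer cake formula replaced by a telescoping sum over generations. When the running maximum
  of the averages of \<open>w\<close> jumps from \<open>a\<close> to \<open>b\<close> on a subcube \<open>P\<close>, then \<open>b\<close> is the average over \<open>P\<close> and
  \<open>b \<le> 2 ^ d * a\<close>; the definition of \<open>Ainf w\<close>, applied to \<open>P\<close>, bounds the integral of \<open>M\<close> over \<open>P\<close> by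
  \<open>Ainf w * b * |P|\<close>, and \<open>b * (b powr \<epsilon> - a powr \<epsilon>) \<le> 2 ^ d * \<epsilon> * (b powr (1 + \<epsilon>) - a powr (1 + \<epsilon>))\<close>.
  Summing over all jumps bounds first the integral of \<open>M powr (1 + \<epsilon>)\<close> and then that of
  \<open>w * M powr \<epsilon>\<close>, and \<open>w \<le> M\<close> almost everywhere.

  Part (b) uses the weak type \<open>(r, r)\<close> inequality for the maximal function, a consequence of the
  Vitali covering lemma, at the levels \<open>2 ^ k * \<tau>\<close> with \<open>\<tau>\<close> the right-hand side of the
  reverse Hoelder inequality; the resulting geometric series has ratio \<open>2 powr (1 - r)\<close>, whence the
  factor \<open>r / (r - 1)\<close>.
\<close>

subsection \<open>Dyadic cubes\<close>

text \<open>Half-open cubes are used because a cube is then the exact disjoint union of its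
  \<open>2 ^ d\<close> dyadic children. The closed cubes of the theorem differ from them only by
  part of the boundary, a null set.\<close>

definition hbox :: "'a::euclidean_space \<Rightarrow> real \<Rightarrow> 'a set" where
  "hbox a s = {x. \<forall>i\<in>Basis. a \<bullet> i \<le> x \<bullet> i \<and> x \<bullet> i < a \<bullet> i + s}"

text \<open>Children are indexed by subsets \<open>B\<close> of the basis: \<open>B\<close> collects
  the coordinates in which the child occupies the upper half of the parent.
  \<open>upper_half\<close> recovers this index from a point.\<close>

definition subcorner :: "'a::euclidean_space \<Rightarrow> real \<Rightarrow> 'a set \<Rightarrow> 'a" where
  "subcorner a s B = a + (s / 2) *\<^sub>R \<Sum>B"

definition upper_half :: "'a::euclidean_space \<Rightarrow> real \<Rightarrow> 'a \<Rightarrow> 'a set" where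
  "upper_half a s x = {i \<in> Basis. a \<bullet> i + s / 2 \<le> x \<bullet> i}"

lemma upper_half_subset: "upper_half a s x \<in> Pow Basis"
  by (auto simp: upper_half_def)

lemma inner_sum_Basis_subset:
  assumes "B \<subseteq> Basis" "i \<in> Basis"
  shows "\<Sum>B \<bullet> i = (if i \<in> B then 1 else 0)"
proof -
  have "\<Sum>B \<bullet> i = (\<Sum>b\<in>B. if b = i then 1 else 0)"
    unfolding inner_sum_left using assms by (intro sum.cong) (auto simp: inner_Basis)
  then show ?thesis
    using assms finite_subset[OF assms(1) finite_Basis] by simp
qed

lemma subcorner_inner:
  assumes "B \<subseteq> Basis" "i \<in> Basis"
  shows "subcorner a s B \<bullet> i = (if i \<in> B then a \<bullet> i + s / 2 else a \<bullet> i)"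
  using assms by (simp add: subcorner_def inner_add_left inner_sum_Basis_subset)

lemma hbox_subcorner_iff:
  assumes "B \<subseteq> Basis" "s > 0"
  shows "x \<in> hbox (subcorner a s B) (s / 2) \<longleftrightarrow> x \<in> hbox a s \<and> upper_half a s x = B"
proof
  note inner = subcorner_inner[OF assms(1)]
  { assume *: "x \<in> hbox (subcorner a s B) (s / 2)"
    have "a \<bullet> i \<le> x \<bullet> i \<and> x \<bullet> i < a \<bullet> i + s \<and> (i \<in> B \<longleftrightarrow> a \<bullet> i + s / 2 \<le> x \<bullet> i)"
      if "i \<in> Basis" for i
      using * that inner[OF that, of a s] assms(2) by (auto simp: hbox_def split: if_splits)
    then show "x \<in> hbox a s \<and> upper_half a s x = B"
      using assms(1) by (auto simp: hbox_def upper_half_def) }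
  { assume *: "x \<in> hbox a s \<and> upper_half a s x = B"
    have "subcorner a s B \<bullet> i \<le> x \<bullet> i \<and> x \<bullet> i < subcorner a s B \<bullet> i + s / 2"
      if "i \<in> Basis" for i
      using * that inner[OF that, of a s] by (auto simp: hbox_def upper_half_def)
    then show "x \<in> hbox (subcorner a s B) (s / 2)"
      by (auto simp: hbox_def) }
qed

lemma sum_indicator_hbox:
  fixes g :: "'a::euclidean_space set \<Rightarrow> ennreal"
  assumes "s > 0"
  shows "(\<Sum>B\<in>Pow Basis. g B * indicator (hbox (subcorner a s B) (s / 2)) x)
    = g (upper_half a s x) * indicator (hbox a s) x"
proof -
  have "(\<Sum>B\<in>Pow Basis. g B * indicator (hbox (subcorner a s B) (s / 2)) x)
    = (\<Sum>B\<in>Pow Basis. if upper_half a s x = B then g B * indicator (hbox a s) x else 0)"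
    using assms by (intro sum.cong) (auto simp: hbox_subcorner_iff indicator_def)
  also have "\<dots> = g (upper_half a s x) * indicator (hbox a s) x"
    using upper_half_subset[of a s x] by (subst sum.delta') auto
  finally show ?thesis .
qed

lemma hbox_borel [measurable]: "hbox a s \<in> sets borel"
proof -
  have "hbox a s = (\<Inter>i\<in>Basis. {x. a \<bullet> i \<le> x \<bullet> i} \<inter> {x. x \<bullet> i < a \<bullet> i + s})"
    by (auto simp: hbox_def)
  also have "\<dots> \<in> sets borel"
    by (intro sets.finite_INT) auto
  finally show ?thesis .
qed

lemma hbox_lebesgue [measurable]: "hbox a s \<in> sets lebesgue"
  using hbox_borel by simp

lemma box_subset_hbox: "box a (a + s *\<^sub>R One) \<subseteq> hbox a s"
  and hbox_subset_cbox: "hbox a s \<subseteq> cbox a (a + s *\<^sub>R One)"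
  by (force simp: hbox_def mem_box inner_add_left)+

lemma AE_hbox_cbox: "AE x in lebesgue. x \<in> hbox a s \<longleftrightarrow> x \<in> cbox a (a + s *\<^sub>R One)"
proof -
  have "negligible (cbox a (a + s *\<^sub>R One) - box a (a + s *\<^sub>R One))"
    by (rule negligible_frontier_interval)
  then have "AE x in lebesgue. x \<notin> cbox a (a + s *\<^sub>R One) - box a (a + s *\<^sub>R One)"
    by (intro AE_not_in) (simp add: negligible_iff_null_sets)
  then show ?thesis
    by eventually_elim (use box_subset_hbox[of a s] hbox_subset_cbox[of a s] in auto)
qed

lemma nn_integral_hbox_cbox:
  "(\<integral>\<^sup>+x\<in>hbox a s. f x \<partial>lebesgue) = (\<integral>\<^sup>+x\<in>cbox a (a + s *\<^sub>R One). f x \<partial>lebesgue)"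
  using AE_hbox_cbox[of a s] by (intro nn_integral_cong_AE) (auto simp: indicator_def)

lemma emeasure_cube:
  assumes "s > 0"
  shows "emeasure lebesgue (cbox a (a + s *\<^sub>R One :: 'a::euclidean_space)) = ennreal (s ^ DIM('a))"
  using assms by (simp add: emeasure_lborel_cbox_eq inner_add_left)

lemma measure_cube:
  assumes "s > 0"
  shows "measure lebesgue (cbox a (a + s *\<^sub>R One :: 'a::euclidean_space)) = s ^ DIM('a)"
  using emeasure_cube[OF assms, of a] assms by (simp add: measure_def)

lemma nn_integral_hbox_one:
  assumes "s > 0"
  shows "(\<integral>\<^sup>+x\<in>hbox (a::'a::euclidean_space) s. 1 \<partial>lebesgue) = ennreal (s ^ DIM('a))"
  unfolding nn_integral_hbox_cbox using emeasure_cube[OF assms, of a] by simp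

text \<open>The inductive step of every integral over the dyadic tree. The integrand may depend on
  the child containing \<open>x\<close>, which is what a running maximum requires.\<close>

lemma nn_integral_hbox_split:
  fixes F :: "'a::euclidean_space set \<Rightarrow> 'a \<Rightarrow> ennreal"
  assumes "s > 0" and [measurable]: "\<And>B. B \<subseteq> Basis \<Longrightarrow> F B \<in> borel_measurable lebesgue"
  shows "(\<integral>\<^sup>+x\<in>hbox a s. F (upper_half a s x) x \<partial>lebesgue)
    = (\<Sum>B\<in>Pow Basis. \<integral>\<^sup>+x\<in>hbox (subcorner a s B) (s / 2). F B x \<partial>lebesgue)"
proof -
  have "(\<Sum>B\<in>Pow Basis. \<integral>\<^sup>+x\<in>hbox (subcorner a s B) (s / 2). F B x \<partial>lebesgue)
    = (\<integral>\<^sup>+x. (\<Sum>B\<in>Pow Basis. F B x * indicator (hbox (subcorner a s B) (s / 2)) x) \<partial>lebesgue)"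
    by (subst nn_integral_sum) auto
  then show ?thesis
    by (simp add: sum_indicator_hbox[OF assms(1)])
qed

text \<open>\<open>upper_half a s\<close> takes finitely many values, each on a set cut out by
  finitely many coordinate inequalities, so selecting a function by it preserves
  measurability.\<close>

lemma measurable_upper_half_compose:
  fixes F :: "'a::euclidean_space set \<Rightarrow> 'a \<Rightarrow> 'b"
  assumes "\<And>B. B \<subseteq> Basis \<Longrightarrow> F B \<in> measurable lebesgue N"
  shows "(\<lambda>x. F (upper_half a s x) x) \<in> measurable lebesgue N"
proof (rule measurable_compose_countable'[where I = "Pow Basis"])
  have "{x. upper_half a s x = B} \<in> sets lebesgue" if "B \<in> Pow Basis" for B
  proof -
    have "upper_half a s x = B \<longleftrightarrow> (\<forall>i\<in>Basis. i \<in> B \<longleftrightarrow> a \<bullet> i + s / 2 \<le> x \<bullet> i)" for x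
      unfolding upper_half_def using that by blast
    then have "{x. upper_half a s x = B} = {x \<in> space borel. \<forall>i\<in>Basis. i \<in> B \<longleftrightarrow> a \<bullet> i + s / 2 \<le> x \<bullet> i}"
      by simp
    also have "\<dots> \<in> sets borel"
      by measurable
    finally show ?thesis by simp
  qed
  then show "upper_half a s \<in> measurable lebesgue (count_space (Pow Basis))"
    by (subst measurable_count_space_eq2) (auto simp: vimage_def finite_Pow_iff upper_half_def)
qed (use assms in \<open>auto intro: countable_finite\<close>)

text \<open>\<open>tree v W \<Phi> n a s m\<close> sums \<open>W * \<Phi> M\<close> over the dyadic subcubes of generation \<open>n\<close>, where \<open>M\<close> is
  the maximum of \<open>m\<close> and of the averages \<open>v\<close> along the path to the subcube.\<close>

primrec tree :: "('a::euclidean_space \<Rightarrow> real \<Rightarrow> real) \<Rightarrow> ('a \<Rightarrow> real \<Rightarrow> real) \<Rightarrow> (real \<Rightarrow> real)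
    \<Rightarrow> nat \<Rightarrow> 'a \<Rightarrow> real \<Rightarrow> real \<Rightarrow> real" where
  "tree v W \<Phi> 0 = (\<lambda>a s m. W a s * \<Phi> m)"
| "tree v W \<Phi> (Suc n) = (\<lambda>a s m. \<Sum>B\<in>Pow Basis. tree v W \<Phi> n (subcorner a s B) (s / 2)
      (max m (v (subcorner a s B) (s / 2))))"

text \<open>The pointwise counterpart of \<open>tree\<close>: the running maximum seen by
  \<open>x\<close> after \<open>n\<close> generations. The recursion peels off the coarsest
  generation and carries the maximum so far in \<open>m\<close>, hence inductions generalize
  \<open>a\<close>, \<open>s\<close> and \<open>m\<close>.\<close>

primrec dymax :: "('a::euclidean_space \<Rightarrow> real \<Rightarrow> real) \<Rightarrow> nat \<Rightarrow> 'a \<Rightarrow> real \<Rightarrow> real \<Rightarrow> 'a \<Rightarrow> real" where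
  "dymax v 0 = (\<lambda>a s m x. m)"
| "dymax v (Suc n) = (\<lambda>a s m x. dymax v n (subcorner a s (upper_half a s x)) (s / 2)
      (max m (v (subcorner a s (upper_half a s x)) (s / 2))) x)"

lemma dymax_measurable [measurable]: "dymax v n a s m \<in> borel_measurable lebesgue"
proof (induction n arbitrary: a s m)
  case (Suc n)
  show ?case
    unfolding dymax.simps
    by (rule measurable_upper_half_compose[where F = "\<lambda>B. dymax v n (subcorner a s B) (s / 2)
      (max m (v (subcorner a s B) (s / 2)))"]) (rule Suc)
qed simp

lemma dymax_ge: "m \<le> dymax v n a s m x"
proof (induction n arbitrary: a s m)
  case (Suc n)
  show ?case
    unfolding dymax.simps by (rule order_trans[OF max.cobounded1 Suc])
qed simp

lemma dymax_le_Suc: "dymax v n a s m x \<le> dymax v (Suc n) a s m x"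
proof (induction n arbitrary: a s m)
  case (Suc n)
  show ?case
    by (subst (1 2) dymax.simps(2)) (rule Suc)
qed simp

text \<open>Turns integrals into the finite sums \<open>tree\<close>, on which the jump argument is
  pure real arithmetic. Nonnegativity is part of the induction, since \<open>ennreal\<close> is
  additive only on nonnegative reals.\<close>

lemma nn_integral_dymax:
  fixes f :: "'a::euclidean_space \<Rightarrow> ennreal"
  assumes [measurable]: "f \<in> borel_measurable lebesgue" "\<Phi> \<in> borel_measurable borel"
    and W: "\<And>a s. s > 0 \<Longrightarrow> (\<integral>\<^sup>+x\<in>hbox a s. f x \<partial>lebesgue) = ennreal (W a s)"
    and nonneg: "\<And>a s. 0 < s \<Longrightarrow> 0 \<le> W a s" "\<And>m. 0 \<le> m \<Longrightarrow> 0 \<le> \<Phi> m"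
    and "s > 0" "m \<ge> 0"
  shows "(\<integral>\<^sup>+x\<in>hbox a s. f x * ennreal (\<Phi> (dymax v n a s m x)) \<partial>lebesgue) = ennreal (tree v W \<Phi> n a s m)
    \<and> 0 \<le> tree v W \<Phi> n a s m"
  using \<open>s > 0\<close> \<open>m \<ge> 0\<close>
proof (induction n arbitrary: a s m)
  case 0
  have "(\<integral>\<^sup>+x\<in>hbox a s. f x * ennreal (\<Phi> m) \<partial>lebesgue)
      = (\<integral>\<^sup>+x. ennreal (\<Phi> m) * (f x * indicator (hbox a s) x) \<partial>lebesgue)"
    by (intro nn_integral_cong) (auto simp: mult_ac)
  also have "\<dots> = ennreal (\<Phi> m) * ennreal (W a s)"
    using W[OF 0(1), of a] by (subst nn_integral_cmult) auto
  finally show ?case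
    using 0 nonneg by (simp add: ennreal_mult mult.commute)
next
  case (Suc n)
  define F where "F = (\<lambda>B x. f x * ennreal (\<Phi> (dymax v n (subcorner a s B) (s / 2)
      (max m (v (subcorner a s B) (s / 2))) x)))"
  define t where "t = (\<lambda>B. tree v W \<Phi> n (subcorner a s B) (s / 2) (max m (v (subcorner a s B) (s / 2))))"
  have IH: "(\<integral>\<^sup>+x\<in>hbox (subcorner a s B) (s / 2). F B x \<partial>lebesgue) = ennreal (t B) \<and> 0 \<le> t B" for B
    unfolding F_def t_def using Suc.prems by (intro Suc.IH) auto
  have "(\<integral>\<^sup>+x\<in>hbox a s. F (upper_half a s x) x \<partial>lebesgue)
    = (\<Sum>B\<in>Pow Basis. \<integral>\<^sup>+x\<in>hbox (subcorner a s B) (s / 2). F B x \<partial>lebesgue)"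
    using Suc.prems unfolding F_def by (intro nn_integral_hbox_split) auto
  also have "\<dots> = (\<Sum>B\<in>Pow Basis. ennreal (t B))"
    using IH by (intro sum.cong) blast+
  also have "\<dots> = ennreal (\<Sum>B\<in>Pow Basis. t B)"
    using IH by (intro sum_ennreal) blast
  finally have "(\<integral>\<^sup>+x\<in>hbox a s. F (upper_half a s x) x \<partial>lebesgue) = ennreal (\<Sum>B\<in>Pow Basis. t B)" .
  moreover have "0 \<le> (\<Sum>B\<in>Pow Basis. t B)"
    using IH by (intro sum_nonneg) blast
  ultimately show ?case
    unfolding F_def t_def tree.simps dymax.simps by blast
qed

subsection \<open>The jump argument\<close>

text \<open>By homogeneity only \<open>t = b / a\<close> matters, with
  \<open>1 \<le> t \<le> D\<close>. Bernoulli gives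
  \<open>t powr \<epsilon> - 1 \<le> \<epsilon> * (t - 1)\<close>, the factor \<open>t\<close> is
  bounded by \<open>D\<close>, and \<open>t - 1 \<le> t powr (1 + \<epsilon>) - 1\<close>.\<close>

lemma powr_increment_le:
  fixes a b D \<epsilon> :: real
  assumes "0 < a" "a \<le> b" "b \<le> D * a" "0 < \<epsilon>" "\<epsilon> \<le> 1"
  shows "b * (b powr \<epsilon> - a powr \<epsilon>) \<le> D * \<epsilon> * (b powr (1 + \<epsilon>) - a powr (1 + \<epsilon>))"
proof -
  define t where "t = b / a"
  have t: "t \<ge> 1" "t \<le> D" "b = t * a"
    using assms by (auto simp: t_def field_simps)
  have "t powr \<epsilon> \<le> 1 + \<epsilon> * (t - 1)"
  proof -
    \<comment> \<open>Young's inequality with second factor 1 is Bernoulli's inequality for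
      exponents at most 1.\<close>
    have "t powr \<epsilon> * 1 powr (1 - \<epsilon>) \<le> \<epsilon> * t + (1 - \<epsilon>) * 1"
      using t assms by (intro Youngs_inequality_0) auto
    then show ?thesis by (simp add: algebra_simps)
  qed
  moreover have "t powr \<epsilon> \<ge> 1" using t assms by (simp add: ge_one_powr_ge_zero)
  ultimately have 1: "t * (t powr \<epsilon> - 1) \<le> D * (\<epsilon> * (t - 1))"
    using t by (intro mult_mono) auto
  have "t powr (1 + \<epsilon>) = t * t powr \<epsilon>" using t by (simp add: powr_add)
  moreover have "t * t powr \<epsilon> \<ge> t * 1" using t \<open>t powr \<epsilon> \<ge> 1\<close> by (intro mult_left_mono) auto
  ultimately have "D * \<epsilon> * (t - 1) \<le> D * \<epsilon> * (t powr (1 + \<epsilon>) - 1)"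
    using t assms by (intro mult_left_mono) auto
  with 1 have "t * (t powr \<epsilon> - 1) \<le> D * \<epsilon> * (t powr (1 + \<epsilon>) - 1)"
    by (simp add: mult.assoc)
  then have "a powr (1 + \<epsilon>) * (t * (t powr \<epsilon> - 1)) \<le> a powr (1 + \<epsilon>) * (D * \<epsilon> * (t powr (1 + \<epsilon>) - 1))"
    by (intro mult_left_mono) auto
  moreover have "b powr (1 + \<epsilon>) = t powr (1 + \<epsilon>) * a powr (1 + \<epsilon>)" "b powr \<epsilon> = t powr \<epsilon> * a powr \<epsilon>"
    using t assms by (simp_all add: t(3) powr_mult)
  moreover have "a powr (1 + \<epsilon>) = a * a powr \<epsilon>"
    using assms by (simp add: powr_add)
  moreover have "b * (t powr \<epsilon> * a powr \<epsilon> - a powr \<epsilon>) = a * a powr \<epsilon> * (t * (t powr \<epsilon> - 1))"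
    unfolding t(3) by (simp only: algebra_simps)
  moreover have "a * a powr \<epsilon> * (D * \<epsilon> * (t powr (1 + \<epsilon>) - 1))
      = D * \<epsilon> * (t powr (1 + \<epsilon>) * (a * a powr \<epsilon>) - a * a powr \<epsilon>)"
    by (simp only: algebra_simps)
  ultimately show ?thesis
    by simp
qed

text \<open>What the jump argument uses of a weight: \<open>W\<close> is the mass of a dyadic cube,
  \<open>v\<close> its average, and masses are positive and additive over children.\<close>

locale dyadic_averages =
  fixes v W :: "'a::euclidean_space \<Rightarrow> real \<Rightarrow> real"
  assumes W_eq: "s > 0 \<Longrightarrow> W a s = v a s * s ^ DIM('a)"
    and v_pos: "s > 0 \<Longrightarrow> 0 < v a s"
    and W_sum: "s > 0 \<Longrightarrow> (\<Sum>B\<in>Pow Basis. W (subcorner a s B) (s / 2)) = W a s"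
begin

abbreviation vol :: "'a \<Rightarrow> real \<Rightarrow> real" where
  "vol a s \<equiv> s ^ DIM('a)"

lemma vol_sum: "(\<Sum>B\<in>Pow (Basis :: 'a set). (s / 2) ^ DIM('a)) = (s :: real) ^ DIM('a)"
proof -
  have "(\<Sum>B\<in>Pow (Basis :: 'a set). (s / 2) ^ DIM('a)) = 2 ^ DIM('a) * (s / 2) ^ DIM('a)"
    by (simp only: sum_constant card_Pow finite_Basis) simp
  then show ?thesis
    by (simp add: power_divide)
qed

text \<open>A child has at most the mass of its parent and \<open>1 / 2 ^ d\<close> of its
  volume.\<close>

lemma v_subcorner_le:
  assumes "s > 0" "B \<subseteq> Basis"
  shows "v (subcorner a s B) (s / 2) \<le> 2 ^ DIM('a) * v a s"
proof -
  have W_pos: "0 \<le> W (subcorner a s B) (s / 2)" for B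
    using assms v_pos[of "s / 2"] by (simp add: W_eq less_imp_le)
  have "W (subcorner a s B) (s / 2) \<le> (\<Sum>B\<in>Pow Basis. W (subcorner a s B) (s / 2))"
    using assms W_pos by (intro member_le_sum) auto
  also have "\<dots> = v a s * s ^ DIM('a)"
    by (simp only: W_sum[OF assms(1)] W_eq[OF assms(1)])
  also have "W (subcorner a s B) (s / 2) = v (subcorner a s B) (s / 2) * (s / 2) ^ DIM('a)"
    using assms by (intro W_eq) simp
  finally have "v (subcorner a s B) (s / 2) / 2 ^ DIM('a) * s ^ DIM('a) \<le> v a s * s ^ DIM('a)"
    by (simp add: power_divide)
  then have "v (subcorner a s B) (s / 2) / 2 ^ DIM('a) \<le> v a s"
    using assms by (simp only: mult_le_cancel_right_pos zero_less_power)
  then show ?thesis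
    by (simp add: field_simps)
qed

text \<open>\<open>A\<close> stands for the A-infinity constant. The bound is assumed for all cubes
  and all depths because the argument restarts it at each child where a jump occurs.\<close>

context
  fixes A \<epsilon> :: real
  assumes A: "s > 0 \<Longrightarrow> tree v vol (\<lambda>m. m) n a s (v a s) \<le> A * W a s"
    and eps: "0 < \<epsilon>" "\<epsilon> \<le> 1"
begin

text \<open>A child cube raises the running maximum \<open>m\<close> only by making its own average the new
  maximum \<open>b\<close>; the cost of the jump is then absorbed by the increment of \<open>m powr (1 + \<epsilon>)\<close>.\<close>

lemma jump_le:
  fixes m s :: real
  defines "c \<equiv> 2 ^ DIM('a) * \<epsilon>"
  assumes "s > 0" "B \<subseteq> Basis" "v a s \<le> m"
  defines "b \<equiv> max m (v (subcorner a s B) (s / 2))"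
  shows "(b powr \<epsilon> - m powr \<epsilon>) * W (subcorner a s B) (s / 2)
      \<le> c * ((s / 2) ^ DIM('a) * (b powr (1 + \<epsilon>) - m powr (1 + \<epsilon>)))"
    and "(b powr \<epsilon> - m powr \<epsilon>) * tree v vol (\<lambda>m. m) n (subcorner a s B) (s / 2) b
      \<le> A * c * ((s / 2) ^ DIM('a) * (b powr (1 + \<epsilon>) - m powr (1 + \<epsilon>)))"
proof -
  let ?a = "subcorner a s B"
  have m: "0 < m" using v_pos[of s a] assms by simp
  have *: "(b powr \<epsilon> - m powr \<epsilon>) * W ?a (s / 2) \<le> c * ((s / 2) ^ DIM('a) * (b powr (1 + \<epsilon>) - m powr (1 + \<epsilon>)))
    \<and> (b powr \<epsilon> - m powr \<epsilon>) * tree v vol (\<lambda>m. m) n ?a (s / 2) b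
      \<le> A * c * ((s / 2) ^ DIM('a) * (b powr (1 + \<epsilon>) - m powr (1 + \<epsilon>)))"
  proof (cases "v ?a (s / 2) \<le> m")
    case True
    then show ?thesis by (simp add: b_def)
  next
    case False
    then have b: "b = v ?a (s / 2)" "m \<le> b" by (auto simp: b_def)
    have "2 ^ DIM('a) * v a s \<le> 2 ^ DIM('a) * m"
      using assms by (intro mult_left_mono) auto
    then have "b \<le> 2 ^ DIM('a) * m"
      using v_subcorner_le[OF assms(2,3), of a] b by linarith
    then have "(s / 2) ^ DIM('a) * (b * (b powr \<epsilon> - m powr \<epsilon>))
      \<le> (s / 2) ^ DIM('a) * (c * (b powr (1 + \<epsilon>) - m powr (1 + \<epsilon>)))"
      unfolding c_def using m b eps \<open>s > 0\<close> by (intro mult_left_mono powr_increment_le) auto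
    moreover have WW: "W ?a (s / 2) = b * (s / 2) ^ DIM('a)"
      using \<open>s > 0\<close> b by (simp add: W_eq)
    ultimately have 1: "(b powr \<epsilon> - m powr \<epsilon>) * W ?a (s / 2)
        \<le> c * ((s / 2) ^ DIM('a) * (b powr (1 + \<epsilon>) - m powr (1 + \<epsilon>)))"
      by (simp add: mult_ac)
    have "b powr \<epsilon> \<ge> m powr \<epsilon>"
      using m b eps by (intro powr_mono2) auto
    \<comment> \<open>After a jump the running maximum is the child's own average, which is the
      starting value required by hypothesis \<open>A\<close>.\<close>
    moreover have tA: "tree v vol (\<lambda>m. m) n ?a (s / 2) b \<le> A * W ?a (s / 2)"
      using A[of "s / 2" n ?a] \<open>s > 0\<close> b by simp
    ultimately have "(b powr \<epsilon> - m powr \<epsilon>) * tree v vol (\<lambda>m. m) n ?a (s / 2) b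
        \<le> (b powr \<epsilon> - m powr \<epsilon>) * (A * W ?a (s / 2))"
      by (intro mult_left_mono) auto
    also have "\<dots> = A * ((b powr \<epsilon> - m powr \<epsilon>) * W ?a (s / 2))"
      by simp
    also have "\<dots> \<le> A * (c * ((s / 2) ^ DIM('a) * (b powr (1 + \<epsilon>) - m powr (1 + \<epsilon>))))"
    \<comment> \<open>The sign of \<open>A\<close> comes from its hypothesis at depth 0, where the
      tree is a volume times a positive average.\<close>
    proof (rule mult_left_mono[OF 1])
      have "0 < W ?a (s / 2)" using v_pos[of "s / 2" ?a] \<open>s > 0\<close> by (simp add: W_eq)
      moreover have "0 \<le> tree v vol (\<lambda>m. m) 0 ?a (s / 2) (v ?a (s / 2))"
        using v_pos[of "s / 2" ?a] \<open>s > 0\<close> by simp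
      then have "0 \<le> A * W ?a (s / 2)"
        using A[of "s / 2" 0 ?a] \<open>s > 0\<close> by linarith
      ultimately show "0 \<le> A" by (simp add: zero_le_mult_iff)
    qed
    finally show ?thesis using 1 by (simp add: mult.assoc)
  qed
  then show "(b powr \<epsilon> - m powr \<epsilon>) * W (subcorner a s B) (s / 2)
      \<le> c * ((s / 2) ^ DIM('a) * (b powr (1 + \<epsilon>) - m powr (1 + \<epsilon>)))"
    "(b powr \<epsilon> - m powr \<epsilon>) * tree v vol (\<lambda>m. m) n (subcorner a s B) (s / 2) b
      \<le> A * c * ((s / 2) ^ DIM('a) * (b powr (1 + \<epsilon>) - m powr (1 + \<epsilon>)))"
    by blast+
qed

text \<open>The induction hypothesis at a child holds with its new maximum \<open>b\<close>.
  Replacing \<open>b powr \<epsilon>\<close> by \<open>m powr \<epsilon>\<close> costs what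
  \<open>jump_le\<close> bounds, and this is the difference between the subtracted terms for
  \<open>b\<close> and for \<open>m\<close>, so the costs telescope.\<close>

lemma tree_dymax_power_le:
  fixes m s :: real
  defines "c \<equiv> 2 ^ DIM('a) * \<epsilon>"
  assumes "s > 0" "v a s \<le> m"
  shows "tree v vol (\<lambda>m. m powr (1 + \<epsilon>)) n a s m \<le> m powr \<epsilon> * tree v vol (\<lambda>m. m) n a s m
    + A * c * (tree v vol (\<lambda>m. m powr (1 + \<epsilon>)) n a s m - s ^ DIM('a) * m powr (1 + \<epsilon>))"
  using assms(2,3)
proof (induction n arbitrary: a s m)
  case 0
  then have "0 < m" using v_pos[of s a] by simp
  then show ?case by (simp add: powr_add)
next
  case (Suc n)
  define b where "b = (\<lambda>B. max m (v (subcorner a s B) (s / 2)))"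
  define G where "G = (\<lambda>B. tree v vol (\<lambda>m. m powr (1 + \<epsilon>)) n (subcorner a s B) (s / 2) (b B))"
  define I where "I = (\<lambda>B. tree v vol (\<lambda>m. m) n (subcorner a s B) (s / 2) (b B))"
  define q where "q = (s / 2) ^ DIM('a)"
  have "G B \<le> m powr \<epsilon> * I B + A * c * (G B - q * m powr (1 + \<epsilon>))" if "B \<in> Pow Basis" for B
  proof -
    have "G B \<le> b B powr \<epsilon> * I B + A * c * (G B - q * b B powr (1 + \<epsilon>))"
      unfolding G_def I_def q_def using Suc.prems by (intro Suc.IH) (auto simp: b_def)
    moreover have "(b B powr \<epsilon> - m powr \<epsilon>) * I B \<le> A * c * (q * (b B powr (1 + \<epsilon>) - m powr (1 + \<epsilon>)))"
      unfolding I_def q_def b_def c_def using Suc.prems that by (intro jump_le) auto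
    ultimately show ?thesis
      by (simp add: algebra_simps)
  qed
  then have "(\<Sum>B\<in>Pow Basis. G B) \<le> (\<Sum>B\<in>Pow Basis. m powr \<epsilon> * I B + A * c * (G B - q * m powr (1 + \<epsilon>)))"
    by (rule sum_mono)
  also have "\<dots> = m powr \<epsilon> * (\<Sum>B\<in>Pow Basis. I B)
      + A * c * ((\<Sum>B\<in>Pow Basis. G B) - (\<Sum>B\<in>Pow (Basis::'a set). q) * m powr (1 + \<epsilon>))"
    by (simp only: sum.distrib sum_subtractf sum_distrib_left[symmetric]) (simp only: sum_constant mult_ac)
  finally show ?case
    unfolding q_def vol_sum tree.simps G_def I_def b_def .
qed

text \<open>The same telescoping, now with the mass \<open>W\<close> as weight: it is additive over
  children, so only the first bound of \<open>jump_le\<close> enters.\<close>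

lemma tree_weighted_power_le:
  fixes m s :: real
  defines "c \<equiv> 2 ^ DIM('a) * \<epsilon>"
  assumes "s > 0" "v a s \<le> m"
  shows "tree v W (\<lambda>m. m powr \<epsilon>) n a s m \<le> m powr \<epsilon> * W a s
    + c * (tree v vol (\<lambda>m. m powr (1 + \<epsilon>)) n a s m - s ^ DIM('a) * m powr (1 + \<epsilon>))"
  using assms(2,3)
proof (induction n arbitrary: a s m)
  case 0
  then show ?case by simp
next
  case (Suc n)
  define b where "b = (\<lambda>B. max m (v (subcorner a s B) (s / 2)))"
  define G where "G = (\<lambda>B. tree v vol (\<lambda>m. m powr (1 + \<epsilon>)) n (subcorner a s B) (s / 2) (b B))"
  define H where "H = (\<lambda>B. tree v W (\<lambda>m. m powr \<epsilon>) n (subcorner a s B) (s / 2) (b B))"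
  define q where "q = (s / 2) ^ DIM('a)"
  have "H B \<le> m powr \<epsilon> * W (subcorner a s B) (s / 2) + c * (G B - q * m powr (1 + \<epsilon>))" if "B \<in> Pow Basis" for B
  proof -
    have "H B \<le> b B powr \<epsilon> * W (subcorner a s B) (s / 2) + c * (G B - q * b B powr (1 + \<epsilon>))"
      unfolding G_def H_def q_def using Suc.prems by (intro Suc.IH) (auto simp: b_def)
    moreover have "(b B powr \<epsilon> - m powr \<epsilon>) * W (subcorner a s B) (s / 2) \<le> c * (q * (b B powr (1 + \<epsilon>) - m powr (1 + \<epsilon>)))"
      unfolding q_def b_def c_def using Suc.prems that by (intro jump_le) auto
    ultimately show ?thesis
      by (simp add: algebra_simps)
  qed
  then have "(\<Sum>B\<in>Pow Basis. H B) \<le> (\<Sum>B\<in>Pow Basis. m powr \<epsilon> * W (subcorner a s B) (s / 2) + c * (G B - q * m powr (1 + \<epsilon>)))"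
    by (rule sum_mono)
  also have "\<dots> = m powr \<epsilon> * (\<Sum>B\<in>Pow Basis. W (subcorner a s B) (s / 2))
      + c * ((\<Sum>B\<in>Pow Basis. G B) - (\<Sum>B\<in>Pow (Basis::'a set). q) * m powr (1 + \<epsilon>))"
    by (simp only: sum.distrib sum_subtractf sum_distrib_left[symmetric]) (simp only: sum_constant mult_ac)
  finally show ?case
    unfolding q_def vol_sum tree.simps G_def H_def b_def W_sum[OF \<open>s > 0\<close>] .
qed

text \<open>Absorption: at finite depth \<open>G\<close> is a real number, so
  \<open>G \<le> A * X + A * c * G\<close> with \<open>A * c \<le> 1 / 2\<close> yields
  \<open>G \<le> 2 * A * X\<close>. The weighted tree is then at most
  \<open>X + c * G \<le> 2 * X\<close>, uniformly in the depth.\<close>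

lemma tree_weighted_power_le_2:
  assumes small: "A * (2 ^ DIM('a) * \<epsilon>) \<le> 1 / 2" and "s > 0"
  shows "tree v W (\<lambda>m. m powr \<epsilon>) n a s (v a s) \<le> 2 * (s ^ DIM('a) * v a s powr (1 + \<epsilon>))"
proof -
  define c where "c = 2 ^ DIM('a) * \<epsilon>"
  define X where "X = s ^ DIM('a) * v a s powr (1 + \<epsilon>)"
  define G where "G = tree v vol (\<lambda>m. m powr (1 + \<epsilon>)) n a s (v a s)"
  have c: "0 < c" using eps by (simp add: c_def)
  have X: "0 \<le> X" "v a s powr \<epsilon> * W a s = X"
    using v_pos[of s a] \<open>s > 0\<close> by (simp_all add: X_def W_eq powr_add)
  have "W a s > 0" using v_pos[of s a] \<open>s > 0\<close> by (simp add: W_eq)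
  then have "0 \<le> A"
    using A[of s 0 a] \<open>s > 0\<close> v_pos[of s a] by (simp add: W_eq)
  have "v a s powr \<epsilon> * tree v vol (\<lambda>m. m) n a s (v a s) \<le> v a s powr \<epsilon> * (A * W a s)"
    using \<open>s > 0\<close> by (intro mult_left_mono A) auto
  also have "\<dots> = A * X" using X(2) by (simp add: mult_ac)
  finally have "G \<le> A * X + A * c * (G - X)"
    using tree_dymax_power_le[OF \<open>s > 0\<close> order.refl, of n a] unfolding G_def X_def c_def by linarith
  moreover have "0 \<le> A * c * X" using X c \<open>0 \<le> A\<close> by simp
  ultimately have GA: "G \<le> A * X + A * c * G" by (simp add: algebra_simps)
  have "G \<le> 2 * A * X"
  proof (cases "G \<ge> 0")
    case True
    then have "A * c * G \<le> 1 / 2 * G" using small by (intro mult_right_mono) (auto simp: c_def)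
    then show ?thesis using GA by simp
  next
    case False
    moreover have "0 \<le> A * X" using X \<open>0 \<le> A\<close> by simp
    ultimately show ?thesis by linarith
  qed
  then have "c * G \<le> c * (2 * A * X)" using c by (intro mult_left_mono) auto
  also have "\<dots> = 2 * (A * c) * X" by simp
  also have "\<dots> \<le> 1 * X" using small X by (intro mult_right_mono) (auto simp: c_def)
  finally have "X + c * (G - X) \<le> 2 * X"
    using mult_nonneg_nonneg[OF less_imp_le[OF c] X(1)] by (simp only: algebra_simps)
  moreover have "tree v W (\<lambda>m. m powr \<epsilon>) n a s (v a s) \<le> X + c * (G - X)"
    using tree_weighted_power_le[OF \<open>s > 0\<close> order.refl, of n a]
    unfolding X(2) unfolding G_def X_def c_def .
  ultimately show ?thesis by (simp add: X_def)
qed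

end

end

subsection \<open>Differentiation along dyadic cubes\<close>

lemma set_nn_integral_eq_set_integral:
  fixes f :: "'a \<Rightarrow> real"
  assumes "set_integrable M S f" "\<And>x. 0 \<le> f x"
  shows "(\<integral>\<^sup>+x\<in>S. ennreal (f x) \<partial>M) = ennreal (LINT x:S|M. f x)"
proof -
  have "(\<integral>\<^sup>+x. ennreal (indicator S x *\<^sub>R f x) \<partial>M) = ennreal (LINT x:S|M. f x)"
    using assms unfolding set_integrable_def set_lebesgue_integral_def
    by (intro nn_integral_eq_integral) auto
  moreover have "(\<integral>\<^sup>+x\<in>S. ennreal (f x) \<partial>M) = (\<integral>\<^sup>+x. ennreal (indicator S x *\<^sub>R f x) \<partial>M)"
    by (intro nn_integral_cong) (auto simp: indicator_def)
  ultimately show ?thesis by simp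
qed

text \<open>Bounds are first proved for the nonnegative integral, which can detect divergence. The
  Bochner integral defaults to 0 off the integrable functions, so integrability is transferred
  together with the bound.\<close>

lemma set_integrable_if_set_nn_integral_le:
  fixes f :: "'a \<Rightarrow> real"
  assumes [measurable]: "f \<in> borel_measurable M" "S \<in> sets M" and "\<And>x. 0 \<le> f x"
    and le: "(\<integral>\<^sup>+x\<in>S. ennreal (f x) \<partial>M) \<le> ennreal c" and "0 \<le> c"
  shows "set_integrable M S f" "(LINT x:S|M. f x) \<le> c"
proof -
  have "(\<integral>\<^sup>+x. ennreal (indicator S x *\<^sub>R f x) \<partial>M) = (\<integral>\<^sup>+x\<in>S. ennreal (f x) \<partial>M)"
    by (intro nn_integral_cong) (auto simp: indicator_def)
  also have "\<dots> < \<infinity>"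
    using le by (rule le_less_trans) simp
  finally show *: "set_integrable M S f"
    unfolding set_integrable_def using assms(3) by (intro integrableI_nonneg) auto
  show "(LINT x:S|M. f x) \<le> c"
    using le set_nn_integral_eq_set_integral[OF * assms(3)] \<open>0 \<le> c\<close> by simp
qed

lemma subcube_subset:
  assumes "B \<subseteq> Basis" "s > 0"
  shows "cbox (subcorner a s B) (subcorner a s B + (s / 2) *\<^sub>R One) \<subseteq> cbox a (a + s *\<^sub>R One)"
  using assms by (auto simp: mem_box inner_add_left subcorner_inner[OF assms(1)] split: if_splits) force+

text \<open>The generation-\<open>n\<close> cell containing \<open>x\<close>, for \<open>x\<close>
  in the initial cube. It descends in the same order as \<open>dymax\<close>, so both unfold
  together in inductions.\<close>

primrec dycell :: "nat \<Rightarrow> 'a::euclidean_space \<Rightarrow> real \<Rightarrow> 'a \<Rightarrow> 'a set" where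
  "dycell 0 = (\<lambda>a s x. hbox a s)"
| "dycell (Suc n) = (\<lambda>a s x. dycell n (subcorner a s (upper_half a s x)) (s / 2) x)"

lemma dycell_subset_measurable: "{x. dycell n a s x \<subseteq> U} \<in> sets lebesgue"
proof -
  have "(\<lambda>x. dycell n a s x \<subseteq> U) \<in> measurable lebesgue (count_space UNIV)"
  proof (induction n arbitrary: a s)
    case (Suc n)
    show ?case
      unfolding dycell.simps
      by (rule measurable_upper_half_compose[where F = "\<lambda>B x. dycell n (subcorner a s B) (s / 2) x \<subseteq> U"])
        (rule Suc)
  qed simp
  then show ?thesis by (simp add: pred_def)
qed

lemma in_child_hbox:
  assumes "s > 0" "x \<in> hbox a s"
  shows "x \<in> hbox (subcorner a s (upper_half a s x)) (s / 2)"
  using assms upper_half_subset[of a s x] by (subst hbox_subcorner_iff) auto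

lemma dycell_Suc_subset:
  assumes "s > 0" "x \<in> hbox a s"
  shows "dycell (Suc n) a s x \<subseteq> dycell n a s x"
  using assms
proof (induction n arbitrary: a s)
  case 0
  then show ?case
    using upper_half_subset[of a s x] by (auto simp: hbox_subcorner_iff)
next
  case (Suc n)
  have "s / 2 > 0" using Suc.prems by simp
  then show ?case
    by (subst (1 2) dycell.simps(2)) (rule Suc.IH[OF _ in_child_hbox[OF Suc.prems]])
qed

lemma dycell_dist_le:
  assumes "s > 0" "x \<in> hbox a s" "y \<in> dycell n a s x" "i \<in> Basis"
  shows "\<bar>(y - x) \<bullet> i\<bar> \<le> s / 2 ^ n"
  using assms
proof (induction n arbitrary: a s)
  case 0
  then show ?case by (force simp: hbox_def inner_diff_left)
next
  case (Suc n)
  have "\<bar>(y - x) \<bullet> i\<bar> \<le> s / 2 / 2 ^ n"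
    using Suc.prems by (intro Suc.IH[OF _ in_child_hbox]) auto
  then show ?case by simp
qed

text \<open>The cell has side \<open>s / 2 ^ n\<close>, so by the l1 bound on the norm it lies
  within \<open>d * s / 2 ^ n\<close> of \<open>x\<close>.\<close>

lemma dycell_subset_open:
  assumes "s > 0" "x \<in> hbox a s" "open U" "x \<in> U"
  shows "\<exists>n. dycell n a s x \<subseteq> U"
proof -
  obtain e where e: "e > 0" "ball x e \<subseteq> U"
    using assms open_contains_ball by metis
  have "(\<lambda>n. DIM('a) * (s / 2 ^ n)) \<longlonglongrightarrow> real DIM('a) * 0"
    by (intro tendsto_mult tendsto_const LIMSEQ_divide_realpow_zero) auto
  then have "\<forall>\<^sub>F n in sequentially. DIM('a) * (s / 2 ^ n) < e"
    using e by (simp add: order_tendstoD)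
  then obtain n where n: "DIM('a) * (s / 2 ^ n) < e"
    by (auto simp: eventually_sequentially)
  have "dycell n a s x \<subseteq> ball x e"
  proof
    fix y assume y: "y \<in> dycell n a s x"
    have "norm (y - x) \<le> (\<Sum>i\<in>Basis. \<bar>(y - x) \<bullet> i\<bar>)"
      by (rule norm_le_l1)
    also have "\<dots> \<le> (\<Sum>i\<in>(Basis :: 'a set). s / 2 ^ n)"
      using assms y by (intro sum_mono dycell_dist_le) auto
    finally show "y \<in> ball x e"
      using n by (simp add: dist_norm norm_minus_commute)
  qed
  with e show ?thesis by blast
qed

section \<open>Masses and dyadic averages of a weight\<close>

definition mass :: "('a::euclidean_space \<Rightarrow> real) \<Rightarrow> 'a \<Rightarrow> real \<Rightarrow> real" where
  "mass w a s = (LINT x:hbox a s|lebesgue. w x)"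

definition dyavg :: "('a::euclidean_space \<Rightarrow> real) \<Rightarrow> 'a \<Rightarrow> real \<Rightarrow> real" where
  "dyavg w a s = mass w a s / s ^ DIM('a)"

context
  fixes w :: "'a::euclidean_space \<Rightarrow> real"
  assumes w: "weight w"
begin

lemma weight_measurable [measurable]: "w \<in> borel_measurable lebesgue"
  and weight_nonneg: "0 \<le> w x"
  and weight_integrable: "set_integrable lebesgue (cbox a b) w"
  and weight_pos_AE: "AE x in lebesgue. 0 < w x"
  using w by (auto simp: weight_def)

lemma nn_integral_hbox_weight: "(\<integral>\<^sup>+x\<in>hbox a s. ennreal (w x) \<partial>lebesgue) = ennreal (mass w a s)"
  unfolding mass_def
  using set_integrable_subset[OF weight_integrable hbox_lebesgue hbox_subset_cbox] weight_nonneg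
  by (rule set_nn_integral_eq_set_integral)

text \<open>\<open>mass\<close> is defined on half-open cubes for exact additivity; this returns to
  closed cubes. The null-set comparison takes place in \<open>ennreal\<close>, and nonnegativity
  lets it descend to the reals.\<close>

lemma mass_eq_cbox: "mass w a s = (LINT x:cbox a (a + s *\<^sub>R One)|lebesgue. w x)"
proof -
  have "ennreal (mass w a s) = ennreal (LINT x:cbox a (a + s *\<^sub>R One)|lebesgue. w x)"
    unfolding nn_integral_hbox_weight[symmetric] nn_integral_hbox_cbox
    by (rule set_nn_integral_eq_set_integral[OF weight_integrable weight_nonneg])
  then show ?thesis
    by (subst (asm) ennreal_inj)
      (auto simp: mass_def set_lebesgue_integral_def weight_nonneg intro!: integral_nonneg)
qed

lemma mass_pos:
  assumes "s > 0"
  shows "0 < mass w a s"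
proof (rule ccontr)
  assume "\<not> 0 < mass w a s"
  then have "(\<integral>\<^sup>+x\<in>hbox a s. ennreal (w x) \<partial>lebesgue) = 0"
    unfolding nn_integral_hbox_weight by (simp add: ennreal_neg)
  then have "AE x in lebesgue. ennreal (w x) * indicator (hbox a s) x = 0"
    by (subst (asm) nn_integral_0_iff_AE) auto
  with weight_pos_AE have "AE x in lebesgue. indicator (hbox a s) x = (0 :: ennreal)"
    by eventually_elim auto
  then have "(\<integral>\<^sup>+x\<in>hbox a s. 1 \<partial>lebesgue) = 0"
    by (subst nn_integral_0_iff_AE) auto
  then show False
    using assms by (simp only: nn_integral_hbox_one) simp
qed

lemma mass_sum:
  assumes "s > 0"
  shows "(\<Sum>B\<in>Pow Basis. mass w (subcorner a s B) (s / 2)) = mass w a s"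
proof -
  have pos: "0 < mass w (subcorner a s B) (s / 2)" for B
    using assms by (intro mass_pos) simp
  have "ennreal (mass w a s) = (\<Sum>B\<in>Pow Basis. ennreal (mass w (subcorner a s B) (s / 2)))"
    unfolding nn_integral_hbox_weight[symmetric] using assms
    by (rule nn_integral_hbox_split[where F = "\<lambda>_ x. ennreal (w x)"]) simp
  also have "\<dots> = ennreal (\<Sum>B\<in>Pow Basis. mass w (subcorner a s B) (s / 2))"
    using pos by (intro sum_ennreal less_imp_le)
  finally have "ennreal (mass w a s) = ennreal (\<Sum>B\<in>Pow Basis. mass w (subcorner a s B) (s / 2))" .
  moreover have "0 \<le> (\<Sum>B\<in>Pow Basis. mass w (subcorner a s B) (s / 2))"
    using pos by (intro sum_nonneg less_imp_le)
  ultimately show ?thesis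
    using mass_pos[OF assms, of a] by simp
qed

interpretation dyadic_averages "dyavg w" "mass w"
  by unfold_locales (auto simp: dyavg_def mass_pos mass_sum)

text \<open>A dyadic substitute for the Lebesgue differentiation theorem: dyadic cubes inside \<open>U\<close> that meet
  \<open>E\<close> have average at most \<open>\<kappa>\<close>, whereas \<open>w\<close> is at least \<open>\<mu>\<close> on \<open>E\<close>. Taking \<open>U\<close> to be an open set barely
  larger than \<open>E\<close> forces \<open>E\<close> to be null when \<open>\<kappa> < \<mu>\<close>.\<close>

lemma density_estimate:
  assumes [measurable]: "E \<in> sets lebesgue" "U \<in> sets lebesgue" and "0 < \<kappa>" "0 \<le> \<mu>"
    and E: "\<And>x. x \<in> E \<Longrightarrow> \<mu> \<le> w x"
    and "s > 0" "dyavg w a s \<le> m" "\<And>x. x \<in> E \<Longrightarrow> x \<in> hbox a s \<Longrightarrow> dymax (dyavg w) n a s m x \<le> \<kappa>"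
  shows "(\<integral>\<^sup>+x\<in>hbox a s. ennreal \<mu> * indicator (E \<inter> {x. dycell n a s x \<subseteq> U}) x \<partial>lebesgue)
    \<le> (\<integral>\<^sup>+x\<in>hbox a s. ennreal \<kappa> * indicator U x \<partial>lebesgue)"
  using assms(6-)
proof (induction n arbitrary: a s m)
  case 0
  \<comment> \<open>Either no point of \<open>E\<close> in the cube counts and the left side
    vanishes, or such a point gives \<open>m \<le> \<kappa>\<close>. In the latter case the average
    of \<open>w\<close> is at most \<open>\<kappa>\<close> and the whole cube lies in
    \<open>U\<close>.\<close>
  show ?case
  proof (cases "\<exists>x. x \<in> E \<inter> hbox a s \<and> hbox a s \<subseteq> U")
    case True
    then have "m \<le> \<kappa>" "hbox a s \<subseteq> U" using 0 by auto
    have "(\<integral>\<^sup>+x\<in>hbox a s. ennreal \<mu> * indicator (E \<inter> {x. dycell 0 a s x \<subseteq> U}) x \<partial>lebesgue)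
      \<le> (\<integral>\<^sup>+x\<in>hbox a s. ennreal (w x) \<partial>lebesgue)"
      using E by (intro nn_integral_mono) (auto simp: indicator_def intro!: ennreal_leI)
    also have "\<dots> = ennreal (dyavg w a s * s ^ DIM('a))"
      using 0 by (simp add: nn_integral_hbox_weight dyavg_def)
    also have "\<dots> \<le> ennreal (\<kappa> * s ^ DIM('a))"
      using 0 \<open>m \<le> \<kappa>\<close> by (intro ennreal_leI mult_right_mono) auto
    also have "\<dots> = ennreal \<kappa> * (\<integral>\<^sup>+x\<in>hbox a s. 1 \<partial>lebesgue)"
      using 0 \<open>0 < \<kappa>\<close> by (simp only: nn_integral_hbox_one ennreal_mult'' zero_le_power less_imp_le)
    also have "\<dots> = (\<integral>\<^sup>+x. ennreal \<kappa> * (1 * indicator (hbox a s) x) \<partial>lebesgue)"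
      by (subst nn_integral_cmult) auto
    also have "\<dots> = (\<integral>\<^sup>+x\<in>hbox a s. ennreal \<kappa> * indicator U x \<partial>lebesgue)"
      using \<open>hbox a s \<subseteq> U\<close> by (intro nn_integral_cong) (auto simp: indicator_def)
    finally show ?thesis .
  next
    case False
    then have "(\<integral>\<^sup>+x\<in>hbox a s. ennreal \<mu> * indicator (E \<inter> {x. dycell 0 a s x \<subseteq> U}) x \<partial>lebesgue)
      = (\<integral>\<^sup>+(x::'a). 0 \<partial>lebesgue)"
      by (intro nn_integral_cong) (auto simp: indicator_def)
    then show ?thesis by simp
  qed
next
  case (Suc n)
  let ?c = "\<lambda>B. subcorner a s B"
  have [measurable]: "{x. dycell n b t x \<subseteq> U} \<in> sets lebesgue" for b t
    by (rule dycell_subset_measurable)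
  have "(\<integral>\<^sup>+x\<in>hbox a s. ennreal \<mu> * indicator (E \<inter> {x. dycell (Suc n) a s x \<subseteq> U}) x \<partial>lebesgue)
    = (\<integral>\<^sup>+x\<in>hbox a s. ennreal \<mu> * indicator (E \<inter> {y. dycell n (?c (upper_half a s x)) (s / 2) y \<subseteq> U}) x \<partial>lebesgue)"
    by (intro nn_integral_cong) (auto simp: indicator_def)
  also have "\<dots> = (\<Sum>B\<in>Pow Basis. \<integral>\<^sup>+x\<in>hbox (?c B) (s / 2).
      ennreal \<mu> * indicator (E \<inter> {y. dycell n (?c B) (s / 2) y \<subseteq> U}) x \<partial>lebesgue)"
    by (rule nn_integral_hbox_split[OF \<open>s > 0\<close>, where
        F = "\<lambda>B x. ennreal \<mu> * indicator (E \<inter> {y. dycell n (?c B) (s / 2) y \<subseteq> U}) x"]) measurable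
  also have "\<dots> \<le> (\<Sum>B\<in>Pow Basis. \<integral>\<^sup>+x\<in>hbox (?c B) (s / 2). ennreal \<kappa> * indicator U x \<partial>lebesgue)"
  proof (rule sum_mono)
    fix B :: "'a set" assume B: "B \<in> Pow Basis"
    show "(\<integral>\<^sup>+x\<in>hbox (?c B) (s / 2). ennreal \<mu> * indicator (E \<inter> {y. dycell n (?c B) (s / 2) y \<subseteq> U}) x \<partial>lebesgue)
      \<le> (\<integral>\<^sup>+x\<in>hbox (?c B) (s / 2). ennreal \<kappa> * indicator U x \<partial>lebesgue)"
    proof (rule Suc.IH[where m = "max m (dyavg w (?c B) (s / 2))"])
      fix x assume x: "x \<in> E" "x \<in> hbox (?c B) (s / 2)"
      then have "x \<in> hbox a s" "upper_half a s x = B"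
        using hbox_subcorner_iff[of B s x a] B Suc.prems by auto
      then show "dymax (dyavg w) n (?c B) (s / 2) (max m (dyavg w (?c B) (s / 2))) x \<le> \<kappa>"
        using Suc.prems(3)[OF x(1)] by simp
    qed (use Suc.prems in auto)
  qed
  also have "\<dots> = (\<integral>\<^sup>+x\<in>hbox a s. ennreal \<kappa> * indicator U x \<partial>lebesgue)"
    by (rule nn_integral_hbox_split[OF \<open>s > 0\<close>, where F = "\<lambda>B x. ennreal \<kappa> * indicator U x", symmetric]) measurable
  finally show ?case .
qed

text \<open>Letting the depth grow in \<open>density_estimate\<close> gives
  \<open>\<mu> * |E| \<le> \<kappa> * |U|\<close> for every open \<open>U\<close> containing
  \<open>E\<close>, since cells eventually fit inside \<open>U\<close>. Outer regularity and
  finiteness of \<open>|E|\<close> then force \<open>|E| = 0\<close>.\<close>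

lemma emeasure_dymax_gap:
  assumes "0 < \<kappa>" "\<kappa> < \<mu>" "s > 0"
  shows "emeasure lebesgue {x \<in> hbox a s. \<mu> \<le> w x \<and> (\<forall>n. dymax (dyavg w) n a s (dyavg w a s) x \<le> \<kappa>)} = 0"
    (is "emeasure lebesgue ?E = 0")
proof -
  have [measurable]: "?E \<in> sets lebesgue"
    by measurable
  have open_bound: "ennreal \<mu> * emeasure lebesgue ?E \<le> ennreal \<kappa> * emeasure lebesgue U"
    if U: "open U" "?E \<subseteq> U" for U
  proof -
    define En where "En n = ?E \<inter> {x. dycell n a s x \<subseteq> U}" for n
    have [measurable]: "U \<in> sets lebesgue" using U by simp
    have [measurable]: "En n \<in> sets lebesgue" for n
      unfolding En_def using dycell_subset_measurable[of n a s U] by (intro sets.Int) simp_all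
    have "incseq En"
    proof (intro incseq_SucI subsetI)
      fix n x assume "x \<in> En n"
      then show "x \<in> En (Suc n)"
        using dycell_Suc_subset[OF \<open>s > 0\<close>, of x a n] by (auto simp: En_def simp del: dycell.simps)
    qed
    have "?E = (\<Union>n. En n)"
    proof (intro equalityI subsetI)
      fix x assume x: "x \<in> ?E"
      then have "x \<in> hbox a s" "x \<in> U" using U(2) by auto
      then obtain n where "dycell n a s x \<subseteq> U"
        using dycell_subset_open[OF \<open>s > 0\<close> _ U(1)] by blast
      with x have "x \<in> En n" by (simp only: En_def Int_iff mem_Collect_eq simp_thms)
      then show "x \<in> (\<Union>n. En n)" by blast
    qed (simp add: En_def)
    moreover have "(SUP n. emeasure lebesgue (En n)) = emeasure lebesgue (\<Union>n. En n)"
      using \<open>incseq En\<close> by (intro SUP_emeasure_incseq) auto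
    ultimately have "emeasure lebesgue ?E = (SUP n. emeasure lebesgue (En n))"
      by metis
    also have "ennreal \<mu> * \<dots> = (SUP n. ennreal \<mu> * emeasure lebesgue (En n))"
      by (rule SUP_mult_left_ennreal)
    also have "\<dots> \<le> ennreal \<kappa> * emeasure lebesgue U"
    proof (rule SUP_least)
      fix n
      have "ennreal \<mu> * emeasure lebesgue (En n) = (\<integral>\<^sup>+x. ennreal \<mu> * indicator (En n) x \<partial>lebesgue)"
        by (simp add: nn_integral_cmult_indicator)
      also have "\<dots> = (\<integral>\<^sup>+x\<in>hbox a s. ennreal \<mu> * indicator (?E \<inter> {x. dycell n a s x \<subseteq> U}) x \<partial>lebesgue)"
        unfolding En_def by (intro nn_integral_cong) (auto simp: indicator_def)
      also have "\<dots> \<le> (\<integral>\<^sup>+x\<in>hbox a s. ennreal \<kappa> * indicator U x \<partial>lebesgue)"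
        by (rule density_estimate[OF _ _ \<open>0 < \<kappa>\<close> _ _ \<open>s > 0\<close> order.refl]) (use assms in auto)
      also have "\<dots> \<le> (\<integral>\<^sup>+x. ennreal \<kappa> * indicator U x \<partial>lebesgue)"
        by (intro nn_integral_mono) (auto simp: indicator_def)
      also have "\<dots> = ennreal \<kappa> * emeasure lebesgue U"
        by (simp add: nn_integral_cmult_indicator)
      finally show "ennreal \<mu> * emeasure lebesgue (En n) \<le> ennreal \<kappa> * emeasure lebesgue U" .
    qed
    finally show ?thesis .
  qed
  have "emeasure lebesgue ?E \<le> emeasure lebesgue (cbox a (a + s *\<^sub>R One))"
    using hbox_subset_cbox[of a s] by (intro emeasure_mono) auto
  also have "\<dots> < \<infinity>" unfolding emeasure_cube[OF \<open>s > 0\<close>] by simp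
  finally obtain L where L: "emeasure lebesgue ?E = ennreal L" "0 \<le> L"
    by (cases "emeasure lebesgue ?E") auto
  have "L = 0"
  proof (rule ccontr)
    assume "L \<noteq> 0"
    \<comment> \<open>Chosen so that \<open>\<kappa> * e\<close> is half of the gap
      \<open>\<mu> * L - \<kappa> * L\<close>, leaving a strict contradiction.\<close>
    define e where "e = L * (\<mu> - \<kappa>) / (2 * \<kappa>)"
    have "e > 0" using assms L \<open>L \<noteq> 0\<close> by (simp add: e_def)
    obtain U where U: "open U" "?E \<subseteq> U" "emeasure lebesgue (U - ?E) < ennreal e"
      by (rule sets_lebesgue_outer_open[OF \<open>?E \<in> sets lebesgue\<close> \<open>e > 0\<close>])
    have "U = ?E \<union> (U - ?E)"
      using U(2) by blast
    then have "emeasure lebesgue U = emeasure lebesgue (?E \<union> (U - ?E))"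
      by (rule arg_cong)
    also have "\<dots> \<le> emeasure lebesgue ?E + emeasure lebesgue (U - ?E)"
    proof (rule emeasure_subadditive)
      show "U - ?E \<in> sets lebesgue"
        using U(1) \<open>?E \<in> sets lebesgue\<close> by (intro sets.Diff) simp_all
    qed fact
    also have "\<dots> \<le> ennreal L + ennreal e"
      unfolding L(1) using U(3) by (intro add_mono order.refl less_imp_le)
    finally have "emeasure lebesgue U \<le> ennreal (L + e)"
      using L \<open>e > 0\<close> by simp
    then have "ennreal \<kappa> * emeasure lebesgue U \<le> ennreal \<kappa> * ennreal (L + e)"
      by (intro mult_left_mono) auto
    with open_bound[OF U(1,2)] have "ennreal (\<mu> * L) \<le> ennreal (\<kappa> * (L + e))"
      using assms L \<open>e > 0\<close> by (simp add: ennreal_mult)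
    then have "\<mu> * L \<le> \<kappa> * (L + e)"
      using assms L \<open>e > 0\<close> by (subst (asm) ennreal_le_iff) auto
    moreover have "\<kappa> * e = L * (\<mu> - \<kappa>) / 2"
      using assms by (simp add: e_def)
    moreover have "0 < L * (\<mu> - \<kappa>)"
      using assms L \<open>L \<noteq> 0\<close> by simp
    moreover have "\<kappa> * (L + e) = \<kappa> * L + \<kappa> * e" "L * (\<mu> - \<kappa>) = \<mu> * L - \<kappa> * L"
      by (simp_all only: algebra_simps)
    ultimately show False
      by linarith
  qed
  then show ?thesis unfolding L(1) by simp
qed

text \<open>If \<open>w x\<close> exceeded a bound \<open>t\<close> of all running maxima, two
  rationals would fit strictly between them, putting \<open>x\<close> into one of countably many
  null sets. Upper bounds \<open>t\<close> replace a real supremum because the averages may be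
  unbounded.\<close>

lemma weight_le_dymax_AE:
  assumes "s > 0"
  shows "AE x in lebesgue. x \<in> hbox a s \<longrightarrow>
    (\<forall>t. (\<forall>n. dymax (dyavg w) n a s (dyavg w a s) x \<le> t) \<longrightarrow> w x \<le> t)"
proof -
  let ?D = "\<lambda>n x. dymax (dyavg w) n a s (dyavg w a s) x"
  have "AE x in lebesgue. \<forall>p\<in>\<rat>. \<forall>q\<in>\<rat>. 0 < p \<and> p < q \<longrightarrow>
      \<not> (x \<in> hbox a s \<and> q \<le> w x \<and> (\<forall>n. ?D n x \<le> p))"
  proof (intro AE_ball_countable'[OF _ countable_rat])
    fix p q :: real
    show "AE x in lebesgue. 0 < p \<and> p < q \<longrightarrow> \<not> (x \<in> hbox a s \<and> q \<le> w x \<and> (\<forall>n. ?D n x \<le> p))"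
    proof (cases "0 < p \<and> p < q")
      case True
      have "{x \<in> hbox a s. q \<le> w x \<and> (\<forall>n. ?D n x \<le> p)} \<in> sets lebesgue"
        by measurable
      then have "{x \<in> hbox a s. q \<le> w x \<and> (\<forall>n. ?D n x \<le> p)} \<in> null_sets lebesgue"
        using emeasure_dymax_gap[OF conjunct1[OF True] conjunct2[OF True] assms] by (rule null_setsI[rotated])
      then have "AE x in lebesgue. x \<notin> {x \<in> hbox a s. q \<le> w x \<and> (\<forall>n. ?D n x \<le> p)}"
        by (rule AE_not_in)
      then show ?thesis
        by (rule AE_mp) (rule AE_I2, blast)
    next
      case False
      then show ?thesis by (intro AE_I2) blast
    qed
  qed
  then show ?thesis
  proof (eventually_elim, intro impI allI)
    fix x t
    assume *: "\<forall>p\<in>\<rat>. \<forall>q\<in>\<rat>. 0 < p \<and> p < q \<longrightarrow> \<not> (x \<in> hbox a s \<and> q \<le> w x \<and> (\<forall>n. ?D n x \<le> p))"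
      and x: "x \<in> hbox a s" and t: "\<forall>n. ?D n x \<le> t"
    \<comment> \<open>Makes the lower rational \<open>p\<close> positive, as the null sets above
      require.\<close>
    have "0 < dyavg w a s" using assms by (rule v_pos)
    also have "\<dots> \<le> t" using t[rule_format, of 0] by simp
    finally have "0 < t" .
    show "w x \<le> t"
    proof (rule ccontr)
      assume "\<not> w x \<le> t"
      then obtain p where p: "p \<in> \<rat>" "t < p" "p < w x"
        using Rats_dense_in_real[of t "w x"] by auto
      then obtain q where q: "q \<in> \<rat>" "p < q" "q < w x"
        using Rats_dense_in_real[of p "w x"] by auto
      have D: "\<forall>n. ?D n x \<le> p" using t less_imp_le[OF p(2)] order_trans by blast
      have "0 < p" using \<open>0 < t\<close> p(2) by (rule less_trans)
      then have "\<not> (x \<in> hbox a s \<and> q \<le> w x \<and> (\<forall>n. ?D n x \<le> p))"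
        using *[THEN bspec, OF p(1), THEN bspec, OF q(1)] q(2) by blast
      with x D less_imp_le[OF q(3)] show False by blast
    qed
  qed
qed

text \<open>Since \<open>w\<close> is at most the supremum of the running maxima,
  \<open>w powr (1 + \<epsilon>)\<close> is at most the limit of
  \<open>w * dymax powr \<epsilon>\<close>. Monotone convergence passes the uniform tree bound to
  this limit.\<close>

lemma nn_integral_weight_power_le:
  assumes "0 < \<epsilon>" "s > 0"
    and le: "\<And>n. tree (dyavg w) (mass w) (\<lambda>m. m powr \<epsilon>) n a s (dyavg w a s) \<le> c"
  shows "(\<integral>\<^sup>+x\<in>hbox a s. ennreal (w x powr (1 + \<epsilon>)) \<partial>lebesgue) \<le> ennreal c"
proof -
  let ?D = "\<lambda>n x. dymax (dyavg w) n a s (dyavg w a s) x"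
  have v: "0 < dyavg w a s" using \<open>s > 0\<close> by (rule v_pos)
  have D: "0 < ?D n x" for n x
    using v dymax_ge[of "dyavg w a s" "dyavg w" n a s x] by linarith
  define F where "F = (\<lambda>n x. ennreal (w x) * ennreal (?D n x powr \<epsilon>) * indicator (hbox a s) x)"
  have mono: "incseq F"
    unfolding F_def using D[THEN less_imp_le] dymax_le_Suc assms(1)
    by (intro incseq_SucI le_funI mult_right_mono mult_left_mono ennreal_leI powr_mono2) auto
  have "AE x in lebesgue. ennreal (w x powr (1 + \<epsilon>)) * indicator (hbox a s) x \<le> (SUP n. F n x)"
    using weight_le_dymax_AE[OF \<open>s > 0\<close>]
  proof eventually_elim
    fix x assume x: "x \<in> hbox a s \<longrightarrow> (\<forall>t. (\<forall>n. ?D n x \<le> t) \<longrightarrow> w x \<le> t)"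
    show "ennreal (w x powr (1 + \<epsilon>)) * indicator (hbox a s) x \<le> (SUP n. F n x)"
    proof (cases "x \<in> hbox a s \<and> w x > 0")
      case True
      show ?thesis
      \<comment> \<open>A finite supremum \<open>y\<close> would bound every running maximum by
        \<open>(y / w x) powr (1 / \<epsilon>)\<close>, hence also \<open>w x\<close>; raising this
        to the power \<open>\<epsilon>\<close> gives
        \<open>w x powr (1 + \<epsilon>) \<le> y\<close>.\<close>
      proof (rule ccontr)
        assume "\<not> ?thesis"
        then have lt: "(SUP n. F n x) < ennreal (w x powr (1 + \<epsilon>))" using True by simp
        then obtain y where y: "(SUP n. F n x) = ennreal y" "0 \<le> y"
          by (cases "SUP n. F n x") (auto simp: top_unique)
        have "?D n x \<le> (y / w x) powr (1 / \<epsilon>)" for n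
        proof -
          have "F n x \<le> ennreal y"
            unfolding y(1)[symmetric] by (rule SUP_upper) simp
          then have "w x * ?D n x powr \<epsilon> \<le> y"
            using True y(2) by (simp add: F_def flip: ennreal_mult)
          then have "?D n x powr \<epsilon> \<le> y / w x"
            using True by (simp add: field_simps)
          then have "(?D n x powr \<epsilon>) powr (1 / \<epsilon>) \<le> (y / w x) powr (1 / \<epsilon>)"
            using assms(1) by (intro powr_mono2) auto
          then show ?thesis
            using assms(1) D[of n x] by (simp add: powr_powr)
        qed
        then have "w x \<le> (y / w x) powr (1 / \<epsilon>)"
          using x True by blast
        then have "w x powr \<epsilon> \<le> ((y / w x) powr (1 / \<epsilon>)) powr \<epsilon>"
          using assms(1) True by (intro powr_mono2) auto
        also have "\<dots> = y / w x"
          using assms(1) True y by (simp add: powr_powr)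
        finally have "w x powr (1 + \<epsilon>) \<le> y"
          using True by (simp add: powr_add field_simps)
        then have "ennreal (w x powr (1 + \<epsilon>)) \<le> (SUP n. F n x)"
          unfolding y(1) by (rule ennreal_leI)
        then show False using lt by simp
      qed
    next
      case False
      then have "x \<notin> hbox a s \<or> w x = 0" using weight_nonneg[of x] by auto
      then show ?thesis by auto
    qed
  qed
  then have "(\<integral>\<^sup>+x\<in>hbox a s. ennreal (w x powr (1 + \<epsilon>)) \<partial>lebesgue) \<le> (\<integral>\<^sup>+x. (SUP n. F n x) \<partial>lebesgue)"
    by (rule nn_integral_mono_AE)
  also have "\<dots> = (SUP n. integral\<^sup>N lebesgue (F n))"
    by (rule nn_integral_monotone_convergence_SUP[OF mono]) (simp add: F_def)
  also have "\<dots> \<le> ennreal c"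
  proof (rule SUP_least)
    fix n
    have "integral\<^sup>N lebesgue (F n) = ennreal (tree (dyavg w) (mass w) (\<lambda>m. m powr \<epsilon>) n a s (dyavg w a s))"
      unfolding F_def
      by (rule nn_integral_dymax[THEN conjunct1])
        (use assms v mass_pos in \<open>auto simp: nn_integral_hbox_weight less_imp_le\<close>)
    then show "integral\<^sup>N lebesgue (F n) \<le> ennreal c"
      using le by (simp add: ennreal_leI)
  qed
  finally show ?thesis .
qed

section \<open>From the A-infinity constant to the reverse Hoelder inequality\<close>

lemma dyavg_le_maxfun:
  assumes "s > 0" "cbox a (a + s *\<^sub>R One) \<subseteq> Q" "x \<in> cbox a (a + s *\<^sub>R One)"
  shows "ennreal (dyavg w a s) \<le> maxfun (\<lambda>y. w y * indicator Q y) x"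
proof -
  let ?C = "cbox a (a + s *\<^sub>R One)"
  have "(\<integral>\<^sup>+y\<in>?C. ennreal \<bar>w y * indicator Q y\<bar> \<partial>lebesgue) = (\<integral>\<^sup>+y\<in>?C. ennreal (w y) \<partial>lebesgue)"
    using assms(2) weight_nonneg by (intro nn_integral_cong) (auto simp: indicator_def)
  also have "\<dots> = ennreal (mass w a s)"
    by (simp only: nn_integral_hbox_cbox[symmetric] nn_integral_hbox_weight)
  finally have "ennreal (dyavg w a s) = (\<integral>\<^sup>+y\<in>?C. ennreal \<bar>w y * indicator Q y\<bar> \<partial>lebesgue) / emeasure lebesgue ?C"
    using assms(1) mass_pos[OF assms(1), of a]
    by (simp only: emeasure_cube dyavg_def) (simp add: divide_ennreal)
  then show ?thesis
    unfolding maxfun_def using assms by (auto intro!: SUP_upper2[of ?C] simp: cube_def)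
qed

text \<open>Each average met on the way down is taken over a closed cube that contains
  \<open>x\<close> and lies in \<open>Q\<close>, so it competes in \<open>maxfun\<close>. Only the
  starting value \<open>m\<close> is arbitrary.\<close>

lemma dymax_le_maxfun:
  assumes "s > 0" "cbox a (a + s *\<^sub>R One) \<subseteq> Q" "x \<in> hbox a s"
  shows "ennreal (dymax (dyavg w) n a s m x) \<le> max (ennreal m) (maxfun (\<lambda>y. w y * indicator Q y) x)"
  using assms
proof (induction n arbitrary: a s m)
  case (Suc n)
  let ?c = "subcorner a s (upper_half a s x)"
  have x: "x \<in> hbox ?c (s / 2)"
    using Suc.prems by (intro in_child_hbox)
  have sub: "cbox ?c (?c + (s / 2) *\<^sub>R One) \<subseteq> Q"
    using subcube_subset[of "upper_half a s x" s a] upper_half_subset[of a s x] Suc.prems by auto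
  have "ennreal (dymax (dyavg w) (Suc n) a s m x) \<le>
      max (ennreal (max m (dyavg w ?c (s / 2)))) (maxfun (\<lambda>y. w y * indicator Q y) x)"
    unfolding dymax.simps using Suc.prems sub x by (intro Suc.IH) auto
  moreover have "ennreal (dyavg w ?c (s / 2)) \<le> maxfun (\<lambda>y. w y * indicator Q y) x"
    using sub x hbox_subset_cbox[of ?c "s / 2"] Suc.prems by (intro dyavg_le_maxfun) auto
  ultimately show ?case
    by (auto simp: max_def split: if_splits)
qed simp

text \<open>Discharges hypothesis \<open>A\<close> of the jump argument: the tree with unit density
  is the integral of a dyadic maximal function, which the definition of \<open>Ainf w\<close>
  controls on the cube itself.\<close>

lemma tree_le_Ainf:
  assumes "Ainf w < \<infinity>" "s > 0"
  shows "tree (dyavg w) (\<lambda>a s. s ^ DIM('a)) (\<lambda>m. m) n a s (dyavg w a s) \<le> enn2real (Ainf w) * mass w a s"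
proof -
  let ?Q = "cbox a (a + s *\<^sub>R One)"
  let ?M = "maxfun (\<lambda>y. w y * indicator ?Q y)"
  have v: "0 < dyavg w a s" using \<open>s > 0\<close> by (rule v_pos)
  have "ennreal (tree (dyavg w) (\<lambda>a s. s ^ DIM('a)) (\<lambda>m. m) n a s (dyavg w a s))
    = (\<integral>\<^sup>+x\<in>hbox a s. 1 * ennreal (dymax (dyavg w) n a s (dyavg w a s) x) \<partial>lebesgue)"
    by (rule nn_integral_dymax[THEN conjunct1, symmetric])
      (use assms v in \<open>simp_all add: nn_integral_hbox_one[simplified]\<close>)
  also have "\<dots> \<le> (\<integral>\<^sup>+x\<in>hbox a s. ?M x \<partial>lebesgue)"
  proof (rule nn_integral_mono)
    fix x
    have "ennreal (dymax (dyavg w) n a s (dyavg w a s) x) \<le> ?M x" if x: "x \<in> hbox a s"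
      using dymax_le_maxfun[OF \<open>s > 0\<close> order.refl x, of n "dyavg w a s"]
        dyavg_le_maxfun[OF \<open>s > 0\<close> order.refl, of x a] x hbox_subset_cbox[of a s]
      by (auto simp: max_def split: if_splits)
    then show "1 * ennreal (dymax (dyavg w) n a s (dyavg w a s) x) * indicator (hbox a s) x
        \<le> ?M x * indicator (hbox a s) x"
      by (auto simp: indicator_def)
  qed
  also have "\<dots> = (\<integral>\<^sup>+x\<in>?Q. ?M x \<partial>lebesgue)"
    by (rule nn_integral_hbox_cbox)
  also have "\<dots> \<le> Ainf w * ennreal (mass w a s)"
  proof -
    have wQ: "(\<integral>\<^sup>+x\<in>?Q. ennreal (w x) \<partial>lebesgue) = ennreal (mass w a s)"
      by (simp only: nn_integral_hbox_cbox[symmetric] nn_integral_hbox_weight)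
    have "(\<integral>\<^sup>+x\<in>?Q. ?M x \<partial>lebesgue) / ennreal (mass w a s) \<le> Ainf w"
      unfolding Ainf_def wQ[symmetric] using \<open>s > 0\<close> by (intro SUP_upper) (auto simp: cube_def)
    then have "(\<integral>\<^sup>+x\<in>?Q. ?M x \<partial>lebesgue) / ennreal (mass w a s) * ennreal (mass w a s) \<le> Ainf w * ennreal (mass w a s)"
      by (rule mult_right_mono) simp
    then show ?thesis
      using mass_pos[OF \<open>s > 0\<close>, of a] by (simp add: ennreal_divide_times)
  qed
  also have "\<dots> = ennreal (enn2real (Ainf w) * mass w a s)"
    using assms mass_pos[OF \<open>s > 0\<close>, of a] by (simp add: ennreal_mult less_top)
  finally show ?thesis
    using mass_pos[OF \<open>s > 0\<close>, of a] by (subst (asm) ennreal_le_iff) auto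
qed

theorem reverse_holder:
  assumes fin: "Ainf w < \<infinity>" and Q: "cube Q"
  defines "r \<equiv> 1 + 1 / (2 ^ (11 + DIM('a)) * enn2real (Ainf w))"
  shows "set_integrable lebesgue Q (\<lambda>x. w x powr r)"
    and "(1 / measure lebesgue Q * (LINT x:Q|lebesgue. w x powr r)) powr (1 / r)
      \<le> 2 * (1 / measure lebesgue Q * (LINT x:Q|lebesgue. w x))"
proof -
  obtain a s where s: "s > 0" and Q_eq: "Q = cbox a (a + s *\<^sub>R One)"
    using Q by (auto simp: cube_def)
  define A where "A = enn2real (Ainf w)"
  define \<epsilon> where "\<epsilon> = 1 / (2 ^ (11 + DIM('a)) * A)"
  define V where "V = dyavg w a s"
  have V: "0 < V" unfolding V_def using s by (rule v_pos)
  \<comment> \<open>At depth 0 the tree is the mass, so the constant is at least 1. This excludes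
    division by zero in \<open>r\<close> and gives \<open>\<epsilon> \<le> 1\<close>.\<close>
  have "mass w a s \<le> A * mass w a s"
    using tree_le_Ainf[OF fin s, of 0 a] s by (simp add: A_def dyavg_def)
  then have A: "1 \<le> A" using mass_pos[OF s, of a] by simp
  have eps: "0 < \<epsilon>" "\<epsilon> \<le> 1" "A * (2 ^ DIM('a) * \<epsilon>) \<le> 1 / 2"
  proof -
    show "0 < \<epsilon>" using A by (simp add: \<epsilon>_def)
    have "1 * 1 \<le> 2 ^ (11 + DIM('a)) * A"
      using A by (intro mult_mono one_le_power) auto
    then show "\<epsilon> \<le> 1" by (simp add: \<epsilon>_def divide_le_eq)
    show "A * (2 ^ DIM('a) * \<epsilon>) \<le> 1 / 2" using A by (simp add: \<epsilon>_def power_add)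
  qed
  have r: "r = 1 + \<epsilon>" by (simp add: r_def \<epsilon>_def A_def)
  define c where "c = 2 * (s ^ DIM('a) * V powr (1 + \<epsilon>))"
  have "tree (dyavg w) (mass w) (\<lambda>m. m powr \<epsilon>) n a s (dyavg w a s) \<le> c" for n
    unfolding c_def V_def
    by (rule tree_weighted_power_le_2[where A = A])
      (use tree_le_Ainf[OF fin] eps s in \<open>auto simp: A_def\<close>)
  then have "(\<integral>\<^sup>+x\<in>hbox a s. ennreal (w x powr (1 + \<epsilon>)) \<partial>lebesgue) \<le> ennreal c"
    by (rule nn_integral_weight_power_le[OF eps(1) s])
  then have *: "(\<integral>\<^sup>+x\<in>Q. ennreal (w x powr r) \<partial>lebesgue) \<le> ennreal c"
    unfolding nn_integral_hbox_cbox Q_eq r .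
  have "0 \<le> c" using s by (simp add: c_def)
  have meas: "(\<lambda>x. w x powr r) \<in> borel_measurable lebesgue" "Q \<in> sets lebesgue"
    by (auto simp: Q_eq)
  show "set_integrable lebesgue Q (\<lambda>x. w x powr r)"
    using meas by (rule set_integrable_if_set_nn_integral_le[OF _ _ _ * \<open>0 \<le> c\<close>]) simp
  have "(LINT x:Q|lebesgue. w x powr r) \<le> c"
    using meas by (rule set_integrable_if_set_nn_integral_le[OF _ _ _ * \<open>0 \<le> c\<close>]) simp
  then have "1 / measure lebesgue Q * (LINT x:Q|lebesgue. w x powr r) \<le> 1 / s ^ DIM('a) * c"
    unfolding Q_eq measure_cube[OF s] using s by (intro mult_left_mono) auto
  also have "\<dots> = 2 * V powr r" using s by (simp add: c_def r)
  finally have "(1 / measure lebesgue Q * (LINT x:Q|lebesgue. w x powr r)) powr (1 / r) \<le> (2 * V powr r) powr (1 / r)"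
    using eps by (intro powr_mono2) (auto simp: r set_lebesgue_integral_def intro!: mult_nonneg_nonneg integral_nonneg)
  also have "\<dots> = 2 powr (1 / r) * V"
    using eps V by (simp add: powr_mult powr_powr r)
  also have "\<dots> \<le> 2 powr 1 * V"
    using eps V by (intro mult_right_mono powr_mono) (auto simp: r)
  also have "\<dots> = 2 * (1 / measure lebesgue Q * (LINT x:Q|lebesgue. w x))"
    unfolding V_def dyavg_def mass_eq_cbox Q_eq measure_cube[OF s] by simp
  finally show "(1 / measure lebesgue Q * (LINT x:Q|lebesgue. w x powr r)) powr (1 / r)
      \<le> 2 * (1 / measure lebesgue Q * (LINT x:Q|lebesgue. w x))" .
qed

end

subsection \<open>The weak type inequality\<close>

text \<open>Volume of a ball of radius \<open>5 * d * s\<close> over \<open>s ^ d\<close>: a cube of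
  side \<open>s\<close> lies in the ball of radius \<open>d * s\<close> about its corner, and the
  Vitali lemma enlarges radii by 5.\<close>

definition vitali_const :: "'a::euclidean_space itself \<Rightarrow> real" where
  "vitali_const _ = unit_ball_vol (real DIM('a)) * (5 * real DIM('a)) ^ DIM('a)"

lemma vitali_const_nonneg: "0 \<le> vitali_const TYPE('a::euclidean_space)"
  by (simp add: vitali_const_def)

lemma cube_subset_cball: "cbox a (a + s *\<^sub>R One) \<subseteq> cball (a::'a::euclidean_space) (s * real DIM('a))"
proof
  fix x assume x: "x \<in> cbox a (a + s *\<^sub>R One)"
  have "norm (x - a) \<le> (\<Sum>i\<in>Basis. \<bar>(x - a) \<bullet> i\<bar>)"
    by (rule norm_le_l1)
  also have "\<dots> \<le> (\<Sum>i\<in>(Basis :: 'a set). s)"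
    using x by (intro sum_mono) (force simp: mem_box inner_add_left inner_diff_left)
  finally show "x \<in> cball a (s * real DIM('a))"
    by (simp add: dist_norm norm_minus_commute mult.commute)
qed

lemma emeasure_cball_eq_cube:
  fixes s :: real
  assumes "s > 0"
  shows "emeasure lebesgue (cball (a::'a::euclidean_space) (5 * (s * real DIM('a))))
    = ennreal (vitali_const TYPE('a) * s ^ DIM('a))"
proof -
  have "emeasure lebesgue (cball a (5 * (s * real DIM('a)))) = emeasure lborel (cball a (5 * (s * real DIM('a))))"
    by simp
  also have "\<dots> = ennreal (unit_ball_vol (real DIM('a)) * (5 * (s * real DIM('a))) ^ DIM('a))"
    using assms by (intro emeasure_cball) simp
  finally show ?thesis
    by (simp add: vitali_const_def power_mult_distrib mult_ac)
qed

text \<open>Sums over the Vitali family are integrals over \<open>count_space C\<close>, so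
  exchanging sum and integral becomes a Fubini statement without an enumeration.\<close>

lemma emeasure_UN_le_nn_integral:
  assumes "countable C" "\<And>i. i \<in> C \<Longrightarrow> A i \<in> sets M"
  shows "emeasure M (\<Union>i\<in>C. A i) \<le> (\<integral>\<^sup>+i. emeasure M (A i) \<partial>count_space C)"
proof -
  have "emeasure M (\<Union>i\<in>C. A i) = (\<integral>\<^sup>+x. indicator (\<Union>i\<in>C. A i) x \<partial>M)"
    using assms by (intro nn_integral_indicator[symmetric] sets.countable_UN') auto
  also have "\<dots> \<le> (\<integral>\<^sup>+x. (\<integral>\<^sup>+i. indicator (A i) x \<partial>count_space C) \<partial>M)"
  proof (rule nn_integral_mono)
    fix x
    show "indicator (\<Union>i\<in>C. A i) x \<le> (\<integral>\<^sup>+i. indicator (A i) x \<partial>count_space C)"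
    proof (cases "x \<in> (\<Union>i\<in>C. A i)")
      case True
      then obtain i where i: "i \<in> C" "x \<in> A i" by blast
      have "indicator (\<Union>i\<in>C. A i) x = (indicator (A i) x :: ennreal)"
        using True i by (simp only: indicator_simps)
      then show ?thesis
        using nn_integral_ge_point[OF i(1), of "\<lambda>i. indicator (A i) x"] by (simp only:)
    qed simp
  qed
  also have "\<dots> = (\<integral>\<^sup>+i. (\<integral>\<^sup>+x. indicator (A i) x \<partial>M) \<partial>count_space C)"
    using assms by (intro nn_integral_count_space_nn_integral) auto
  also have "\<dots> = (\<integral>\<^sup>+i. emeasure M (A i) \<partial>count_space C)"
    using assms by (intro nn_integral_cong nn_integral_indicator) auto
  finally show ?thesis .
qed

lemma nn_integral_disjoint_le:
  fixes g :: "'a \<Rightarrow> ennreal"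
  assumes "countable C" and [measurable]: "\<And>i. i \<in> C \<Longrightarrow> A i \<in> sets M" "g \<in> borel_measurable M"
    and disj: "disjoint_family_on A C"
  shows "(\<integral>\<^sup>+i. (\<integral>\<^sup>+x\<in>A i. g x \<partial>M) \<partial>count_space C) \<le> (\<integral>\<^sup>+x. g x \<partial>M)"
proof -
  have "(\<integral>\<^sup>+i. (\<integral>\<^sup>+x\<in>A i. g x \<partial>M) \<partial>count_space C) = (\<integral>\<^sup>+x. (\<integral>\<^sup>+i. g x * indicator (A i) x \<partial>count_space C) \<partial>M)"
    using assms(1) by (intro nn_integral_count_space_nn_integral[symmetric]) auto
  also have "\<dots> \<le> (\<integral>\<^sup>+x. g x \<partial>M)"
  proof (rule nn_integral_mono)
    fix x
    show "(\<integral>\<^sup>+i. g x * indicator (A i) x \<partial>count_space C) \<le> g x"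
    proof (cases "\<exists>j\<in>C. x \<in> A j")
      case True
      then obtain j where j: "j \<in> C" "x \<in> A j" by blast
      have "(\<integral>\<^sup>+i. g x * indicator (A i) x \<partial>count_space C) = (\<integral>\<^sup>+i. g x * indicator {j} i \<partial>count_space C)"
      proof (rule nn_integral_cong)
        fix i assume "i \<in> space (count_space C)"
        then have "x \<in> A i \<longleftrightarrow> i = j"
          using j disj by (auto simp: disjoint_family_on_def)
        then show "g x * indicator (A i) x = g x * indicator {j} i"
          by (simp add: indicator_def)
      qed
      also have "\<dots> = g x"
        using j by simp
      finally show ?thesis by simp
    next
      case False
      then have "(\<integral>\<^sup>+i. g x * indicator (A i) x \<partial>count_space C) = (\<integral>\<^sup>+i. 0 \<partial>count_space C)"
        by (intro nn_integral_cong) auto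
      then show ?thesis by simp
    qed
  qed
  finally show ?thesis .
qed

text \<open>The Vitali selection keeps disjoint balls whose fivefold enlargements cover all cubes of
  large average; each enlargement is paid for by the integral of \<open>g\<close> over its cube. The
  conclusion offers a measurable set \<open>U\<close> that can be integrated directly.\<close>

lemma weak_type_cubes:
  fixes g :: "'a::euclidean_space \<Rightarrow> ennreal"
  assumes [measurable]: "g \<in> borel_measurable lebesgue"
    and fin: "(\<integral>\<^sup>+x. g x \<partial>lebesgue) \<le> ennreal G" and "0 < \<mu>" "0 \<le> G"
  obtains U where "U \<in> sets lebesgue"
    "\<And>P. cube P \<Longrightarrow> ennreal \<mu> * emeasure lebesgue P < (\<integral>\<^sup>+x\<in>P. g x \<partial>lebesgue) \<Longrightarrow> P \<subseteq> U"
    "emeasure lebesgue U \<le> ennreal (vitali_const TYPE('a) * G / \<mu>)"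
proof -
  define Q where "Q = (\<lambda>(a::'a, s). cbox a (a + s *\<^sub>R One))"
  define K where "K = {(a::'a, s). s > 0 \<and> ennreal \<mu> * emeasure lebesgue (Q (a, s)) < (\<integral>\<^sup>+x\<in>Q (a, s). g x \<partial>lebesgue)}"
  define R where "R = (\<lambda>(a::'a, s::real). s * real DIM('a))"
  have large: "ennreal (\<mu> * s ^ DIM('a)) \<le> (\<integral>\<^sup>+x\<in>Q (a, s). g x \<partial>lebesgue)" "s > 0" if "(a, s) \<in> K" for a s
  proof -
    show "s > 0" using that by (simp add: K_def)
    then have "ennreal (\<mu> * s ^ DIM('a)) = ennreal \<mu> * emeasure lebesgue (Q (a, s))"
      unfolding Q_def prod.case emeasure_cube[OF \<open>s > 0\<close>] using \<open>0 < \<mu>\<close> by (intro ennreal_mult) auto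
    also have "\<dots> \<le> (\<integral>\<^sup>+x\<in>Q (a, s). g x \<partial>lebesgue)"
      using that by (simp only: K_def mem_Collect_eq prod.case less_imp_le)
    finally show "ennreal (\<mu> * s ^ DIM('a)) \<le> (\<integral>\<^sup>+x\<in>Q (a, s). g x \<partial>lebesgue)" .
  qed
  \<comment> \<open>Vitali's lemma requires bounded radii: a cube of large average has volume at
    most \<open>G / \<mu>\<close>.\<close>
  have R: "0 < R i \<and> R i \<le> max 1 (G / \<mu>) * DIM('a)" if "i \<in> K" for i
  proof -
    obtain a s where i: "i = (a, s)" by force
    have s: "s > 0" using large(2) that i by simp
    have "ennreal (\<mu> * s ^ DIM('a)) \<le> (\<integral>\<^sup>+x\<in>Q (a, s). g x \<partial>lebesgue)"
      using large(1) that i by simp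
    also have "\<dots> \<le> (\<integral>\<^sup>+x. g x \<partial>lebesgue)"
      by (intro nn_integral_mono) (auto simp: indicator_def)
    also note fin
    finally have "s ^ DIM('a) \<le> G / \<mu>"
      using assms by (simp add: field_simps)
    moreover have "s \<le> s ^ DIM('a)" if "1 \<le> s"
      using that self_le_power[of s "DIM('a)"] by simp
    ultimately have "s \<le> max 1 (G / \<mu>)" by linarith
    then show ?thesis
      using s by (simp add: R_def i)
  qed
  obtain C where C: "countable C" "C \<subseteq> K"
      "pairwise (\<lambda>i j. disjnt (cball (fst i) (R i)) (cball (fst j) (R j))) C"
      and cover: "(\<Union>i\<in>K. cball (fst i) (R i)) \<subseteq> (\<Union>i\<in>C. cball (fst i) (5 * R i))"
    by (rule Vitali_covering_lemma_cballs[OF order.refl R])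
  define U where "U = (\<Union>i\<in>C. cball (fst i) (5 * R i))"
  have Q_sub: "Q i \<subseteq> cball (fst i) (R i)" for i
    using cube_subset_cball by (cases i) (auto simp: Q_def R_def)
  show thesis
  proof
    show "U \<in> sets lebesgue"
      unfolding U_def using C(1) by (intro sets.countable_UN') auto
  next
    fix P :: "'a set"
    assume P: "cube P" "ennreal \<mu> * emeasure lebesgue P < (\<integral>\<^sup>+x\<in>P. g x \<partial>lebesgue)"
    then obtain a s where "s > 0" "P = Q (a, s)"
      by (auto simp: cube_def Q_def)
    with P(2) have "(a, s) \<in> K" by (simp only: K_def mem_Collect_eq prod.case)
    then show "P \<subseteq> U"
      using Q_sub[of "(a, s)"] cover \<open>P = Q (a, s)\<close> unfolding U_def by blast
  next
    let ?c = "vitali_const TYPE('a) / \<mu>"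
    have c: "0 \<le> ?c" using vitali_const_nonneg[where 'a = 'a] \<open>0 < \<mu>\<close> by simp
    have "emeasure lebesgue U \<le> (\<integral>\<^sup>+i. emeasure lebesgue (cball (fst i) (5 * R i)) \<partial>count_space C)"
      unfolding U_def using C(1) by (intro emeasure_UN_le_nn_integral) auto
    also have "\<dots> \<le> (\<integral>\<^sup>+i. ennreal ?c * (\<integral>\<^sup>+x\<in>Q i. g x \<partial>lebesgue) \<partial>count_space C)"
    proof (rule nn_integral_mono)
      fix i assume "i \<in> space (count_space C)"
      then obtain a s where i: "i = (a, s)" "(a, s) \<in> K"
        using C(2) by (cases i) auto
      have "emeasure lebesgue (cball (fst i) (5 * R i)) = ennreal (?c * (\<mu> * s ^ DIM('a)))"
        unfolding i(1) R_def fst_conv prod.case emeasure_cball_eq_cube[OF large(2)[OF i(2)]]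
        using \<open>0 < \<mu>\<close> by simp
      also have "\<dots> = ennreal ?c * ennreal (\<mu> * s ^ DIM('a))"
        using c by (rule ennreal_mult')
      also have "\<dots> \<le> ennreal ?c * (\<integral>\<^sup>+x\<in>Q i. g x \<partial>lebesgue)"
        unfolding i(1) using large(1)[OF i(2)] by (rule mult_left_mono) simp
      finally show "emeasure lebesgue (cball (fst i) (5 * R i)) \<le> ennreal ?c * (\<integral>\<^sup>+x\<in>Q i. g x \<partial>lebesgue)" .
    qed
    also have "\<dots> = ennreal ?c * (\<integral>\<^sup>+i. (\<integral>\<^sup>+x\<in>Q i. g x \<partial>lebesgue) \<partial>count_space C)"
      by (rule nn_integral_cmult) simp
    also have "\<dots> \<le> ennreal ?c * (\<integral>\<^sup>+x. g x \<partial>lebesgue)"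
    proof (intro mult_left_mono nn_integral_disjoint_le C(1))
      show "disjoint_family_on Q C"
        using C(3) Q_sub unfolding disjoint_family_on_def pairwise_def disjnt_def by blast
      show "Q i \<in> sets lebesgue" for i by (cases i) (simp add: Q_def)
    qed auto
    also have "\<dots> \<le> ennreal ?c * ennreal G"
      using fin by (rule mult_left_mono) simp
    also have "\<dots> = ennreal (vitali_const TYPE('a) * G / \<mu>)"
      using c assms by (simp flip: ennreal_mult)
    finally show "emeasure lebesgue U \<le> ennreal (vitali_const TYPE('a) * G / \<mu>)" .
  qed
qed

section \<open>Integrating the maximal function by levels\<close>

lemma le_add_powr:
  fixes f \<mu> r :: real
  assumes "0 \<le> f" "0 < \<mu>" "1 < r"
  shows "f \<le> \<mu> + \<mu> powr (1 - r) * f powr r"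
proof (cases "f \<le> \<mu>")
  case False
  have "f = f powr (1 - r) * f powr r"
    using assms False by (simp flip: powr_add)
  also have "\<dots> \<le> \<mu> powr (1 - r) * f powr r"
    using assms False by (intro mult_right_mono powr_mono2') auto
  finally show ?thesis using assms by simp
next
  case True
  then show ?thesis by (simp add: add_increasing2)
qed

text \<open>Averaging \<open>le_add_powr\<close> over \<open>P\<close> replaces Hoelder's
  inequality: were the average of \<open>f powr r\<close> at most \<open>\<mu> powr r\<close>, that
  of \<open>f\<close> would be at most \<open>\<mu> + \<mu>\<close>.\<close>

lemma large_average_power:
  fixes f :: "'a::euclidean_space \<Rightarrow> real"
  assumes [measurable]: "f \<in> borel_measurable lebesgue" and f: "\<And>x. 0 \<le> f x" and P: "cube P"
    and "0 < \<mu>" "1 < r"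
    and large: "ennreal (2 * \<mu>) < (\<integral>\<^sup>+y\<in>P. ennreal (f y) \<partial>lebesgue) / emeasure lebesgue P"
  shows "ennreal (\<mu> powr r) * emeasure lebesgue P < (\<integral>\<^sup>+y\<in>P. ennreal (f y powr r) \<partial>lebesgue)"
proof (rule ccontr)
  obtain a s where s: "s > 0" "P = cbox a (a + s *\<^sub>R One)"
    using P by (auto simp: cube_def)
  have [measurable]: "P \<in> sets lebesgue" by (simp add: s)
  have eP: "emeasure lebesgue P = ennreal (s ^ DIM('a))"
    unfolding s(2) by (rule emeasure_cube[OF s(1)])
  assume "\<not> ?thesis"
  then have le: "(\<integral>\<^sup>+y\<in>P. ennreal (f y powr r) \<partial>lebesgue) \<le> ennreal (\<mu> powr r) * emeasure lebesgue P"
    by simp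
  have "(\<integral>\<^sup>+y\<in>P. ennreal (f y) \<partial>lebesgue)
      \<le> (\<integral>\<^sup>+y. ennreal \<mu> * indicator P y + ennreal (\<mu> powr (1 - r)) * (ennreal (f y powr r) * indicator P y) \<partial>lebesgue)"
  proof (rule nn_integral_mono)
    fix y
    have "ennreal (f y) \<le> ennreal \<mu> + ennreal (\<mu> powr (1 - r)) * ennreal (f y powr r)"
      using le_add_powr[OF f[of y] \<open>0 < \<mu>\<close> \<open>1 < r\<close>] \<open>0 < \<mu>\<close>
      by (simp flip: ennreal_mult ennreal_plus)
    then show "ennreal (f y) * indicator P y
      \<le> ennreal \<mu> * indicator P y + ennreal (\<mu> powr (1 - r)) * (ennreal (f y powr r) * indicator P y)"
      by (simp add: indicator_def)
  qed
  also have "\<dots> = ennreal \<mu> * emeasure lebesgue P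
      + ennreal (\<mu> powr (1 - r)) * (\<integral>\<^sup>+y\<in>P. ennreal (f y powr r) \<partial>lebesgue)"
    by (subst nn_integral_add, measurable, subst nn_integral_cmult_indicator, measurable,
        subst nn_integral_cmult, measurable)
  also have "\<dots> \<le> ennreal \<mu> * emeasure lebesgue P
      + ennreal (\<mu> powr (1 - r)) * (ennreal (\<mu> powr r) * emeasure lebesgue P)"
    using le by (intro add_left_mono mult_left_mono) auto
  also have "ennreal (\<mu> powr (1 - r)) * (ennreal (\<mu> powr r) * emeasure lebesgue P)
      = ennreal (\<mu> powr (1 - r) * \<mu> powr r) * emeasure lebesgue P"
    by (simp add: ennreal_mult mult.assoc)
  also have "\<mu> powr (1 - r) * \<mu> powr r = \<mu>"
    using \<open>0 < \<mu>\<close> by (simp flip: powr_add)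
  also have "ennreal \<mu> * emeasure lebesgue P + ennreal \<mu> * emeasure lebesgue P = emeasure lebesgue P * ennreal (2 * \<mu>)"
    unfolding eP using s(1) \<open>0 < \<mu>\<close> by (simp flip: ennreal_mult ennreal_plus)
  finally have "(\<integral>\<^sup>+y\<in>P. ennreal (f y) \<partial>lebesgue) / emeasure lebesgue P \<le> ennreal (2 * \<mu>)"
    unfolding eP using s(1) by (intro divide_le_posI_ennreal) auto
  with large show False by simp
qed

text \<open>From \<open>2 powr p \<ge> 1 + p * ln 2 \<ge> 1 + p / 2\<close>; with
  \<open>p = r - 1\<close> the right-hand side is twice the conjugate exponent of
  \<open>r\<close>.\<close>

lemma geometric_bound:
  fixes p :: real
  assumes "p > 0"
  shows "1 / (1 - 2 powr (- p)) \<le> 2 * (1 + 1 / p)"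
proof -
  have "p * (1 / 2) \<le> p * ln 2"
    using assms ln2_ge_two_thirds by (intro mult_left_mono) auto
  also have "1 + p * ln 2 \<le> exp (p * ln 2)"
    by (rule exp_ge_add_one_self)
  also have "exp (p * ln 2) = 2 powr p"
    by (simp add: powr_def)
  finally have X: "1 + p / 2 \<le> 2 powr p" by simp
  define X where "X = (2::real) powr p"
  have X: "1 + p / 2 \<le> X" using X by (simp add: X_def)
  have "1 / (1 - 2 powr (- p)) = X / (X - 1)"
    using X assms by (simp add: X_def powr_minus field_simps)
  also have "\<dots> = 1 + 1 / (X - 1)"
    using X assms by (simp add: field_simps)
  also have "\<dots> \<le> 1 + 1 / (p / 2)"
    using X assms by (intro add_left_mono divide_left_mono) auto
  also have "\<dots> \<le> 2 * (1 + 1 / p)" by simp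
  finally show ?thesis .
qed

lemma nn_integral_maxfun_le:
  fixes f :: "'a::euclidean_space \<Rightarrow> real"
  assumes [measurable]: "f \<in> borel_measurable lebesgue" and f: "\<And>x. 0 \<le> f x"
    and r: "1 < r" and \<tau>: "0 < \<tau>" and V: "0 \<le> V"
    and le: "(\<integral>\<^sup>+x. ennreal (f x powr r) \<partial>lebesgue) \<le> ennreal (\<tau> powr r * V)"
    and Q [measurable]: "Q \<in> sets lebesgue" and eQ: "emeasure lebesgue Q = ennreal V"
  shows "(\<integral>\<^sup>+x\<in>Q. maxfun f x \<partial>lebesgue)
    \<le> ennreal ((2 + 8 * vitali_const TYPE('a)) * (r / (r - 1)) * \<tau> * V)"
proof -
  let ?C = "vitali_const TYPE('a)"
  have C: "0 \<le> ?C" by (rule vitali_const_nonneg)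
  define good where "good k U \<longleftrightarrow> U \<in> sets lebesgue \<and>
    (\<forall>P. cube P \<longrightarrow> ennreal ((2 ^ k * \<tau>) powr r) * emeasure lebesgue P < (\<integral>\<^sup>+x\<in>P. ennreal (f x powr r) \<partial>lebesgue)
      \<longrightarrow> P \<subseteq> U) \<and>
    emeasure lebesgue U \<le> ennreal (?C * (\<tau> powr r * V) / (2 ^ k * \<tau>) powr r)" for k :: nat and U
  have "\<exists>U. good k U" for k
  proof -
    have "(\<lambda>x. ennreal (f x powr r)) \<in> borel_measurable lebesgue" "0 < (2 ^ k * \<tau>) powr r" "0 \<le> \<tau> powr r * V"
      using \<tau> V by auto
    note side = this
    show ?thesis
    proof (rule weak_type_cubes[OF side(1) le side(2,3)])
      fix U
      assume *: "U \<in> sets lebesgue"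
        "\<And>P. cube P \<Longrightarrow> ennreal ((2 ^ k * \<tau>) powr r) * emeasure lebesgue P
          < (\<integral>\<^sup>+x\<in>P. ennreal (f x powr r) \<partial>lebesgue) \<Longrightarrow> P \<subseteq> U"
        "emeasure lebesgue U \<le> ennreal (?C * (\<tau> powr r * V) / (2 ^ k * \<tau>) powr r)"
      show "\<exists>U. good k U"
        unfolding good_def by (intro exI[of _ U] conjI allI impI *)
    qed
  qed
  then obtain U where "\<And>k. good k (U k)"
    using choice[of good] by metis
  then have U [measurable]: "\<And>k. U k \<in> sets lebesgue"
    and cover: "\<And>k P. cube P \<Longrightarrow> ennreal ((2 ^ k * \<tau>) powr r) * emeasure lebesgue P
        < (\<integral>\<^sup>+x\<in>P. ennreal (f x powr r) \<partial>lebesgue) \<Longrightarrow> P \<subseteq> U k"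
    and small: "\<And>k. emeasure lebesgue (U k) \<le> ennreal (?C * (\<tau> powr r * V) / (2 ^ k * \<tau>) powr r)"
    unfolding good_def by blast+
  have in_U: "x \<in> U k" if "ennreal (2 * (2 ^ k * \<tau>)) < maxfun f x" for k x
  proof -
    obtain P where P: "cube P" "x \<in> P"
      "ennreal (2 * (2 ^ k * \<tau>)) < (\<integral>\<^sup>+y\<in>P. ennreal \<bar>f y\<bar> \<partial>lebesgue) / emeasure lebesgue P"
      using \<open>_ < maxfun f x\<close> unfolding maxfun_def less_SUP_iff by blast
    have "ennreal (2 * (2 ^ k * \<tau>)) < (\<integral>\<^sup>+y\<in>P. ennreal (f y) \<partial>lebesgue) / emeasure lebesgue P"
      using P(3) f by (simp only: abs_of_nonneg)
    then have "ennreal ((2 ^ k * \<tau>) powr r) * emeasure lebesgue P < (\<integral>\<^sup>+y\<in>P. ennreal (f y powr r) \<partial>lebesgue)"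
      using \<tau> by (intro large_average_power[OF _ f P(1) _ r]) auto
    then show ?thesis using cover[OF P(1)] P(2) by blast
  qed
  \<comment> \<open>Exceeding level \<open>2 * 2 ^ k * \<tau>\<close> activates the term
    \<open>4 * 2 ^ k * \<tau>\<close>, which is the next level. If the bound failed, every level
    would be exceeded in turn, making the series exceed any real although it is finite.\<close>
  have dom: "maxfun f x \<le> ennreal (2 * \<tau>) + (\<Sum>k. ennreal (4 * (2 ^ k * \<tau>)) * indicator (U k) x)"
    (is "_ \<le> _ + ?S") for x
  proof (rule ccontr)
    assume "\<not> ?thesis"
    then have gt: "ennreal (2 * \<tau>) + ?S < maxfun f x" by simp
    have step: "ennreal (4 * (2 ^ k * \<tau>)) \<le> ?S" if "ennreal (2 * (2 ^ k * \<tau>)) < maxfun f x" for k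
    proof -
      have "ennreal (4 * (2 ^ k * \<tau>)) = (\<Sum>i\<in>{k}. ennreal (4 * (2 ^ i * \<tau>)) * indicator (U i) x)"
        using in_U[OF that] by simp
      also have "\<dots> \<le> ?S" by (intro sum_le_suminf) auto
      finally show ?thesis .
    qed
    have gt': "a < maxfun f x" if "a \<le> ennreal (2 * \<tau>) + ?S" for a
      using that gt by (rule le_less_trans)
    have all: "ennreal (2 * (2 ^ k * \<tau>)) < maxfun f x" for k :: nat
    proof (induction k)
      case 0
      show ?case by (intro gt') simp
    next
      case (Suc k)
      have "2 * (2 ^ Suc k * \<tau>) = 4 * (2 ^ k * \<tau>)" by simp
      then show ?case
        using step[OF Suc] by (intro gt') (simp only: add_increasing zero_le)
    qed
    have "?S < top"
      by (rule less_le_trans[OF gt' top_greatest]) (rule add_increasing[OF zero_le order.refl])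
    then obtain y where y: "?S = ennreal y" "0 \<le> y"
      by (cases ?S) auto
    obtain k :: nat where "y / (4 * \<tau>) < 2 ^ k"
      using real_arch_pow[of 2 "y / (4 * \<tau>)"] by auto
    then have "y < 4 * (2 ^ k * \<tau>)"
      using \<tau> by (simp add: field_simps)
    then show False
      using step[OF all, of k] y by (simp add: ennreal_le_iff)
  qed
  \<comment> \<open>The choice of \<open>\<tau>\<close> as base level cancels
    \<open>\<tau> powr r\<close>, leaving \<open>2 ^ k\<close> against
    \<open>2 powr (k * r)\<close>.\<close>
  have U_le: "ennreal (4 * (2 ^ k * \<tau>)) * emeasure lebesgue (U k) \<le> ennreal (4 * ?C * \<tau> * V * (2 powr (1 - r)) ^ k)" for k
  proof -
    have "(2 ^ k) powr r = (2::real) powr (real k * r)"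
      by (simp only: powr_realpow[symmetric] zero_less_numeral powr_powr)
    also have "real k * r = real k + (r - 1) * real k"
      by (simp only: algebra_simps)
    also have "2 powr \<dots> = 2 ^ k * (2 powr (r - 1)) ^ k"
      by (simp add: powr_add powr_power powr_realpow mult.commute)
    finally have "(2 ^ k * \<tau>) powr r = 2 ^ k * (2 powr (r - 1)) ^ k * \<tau> powr r"
      using \<tau> by (simp only: powr_mult[of "2 ^ k" \<tau>] zero_le_power zero_le_numeral less_imp_le)
    moreover have "(2 powr (1 - r)) ^ k * (2 powr (r - 1)) ^ k = (1 :: real)"
      by (simp flip: power_mult_distrib powr_add)
    then have "(2 powr (1 - r)) ^ k = 1 / (2 powr (r - 1) :: real) ^ k"
      by (simp add: eq_divide_eq)
    ultimately have eq: "4 * (2 ^ k * \<tau>) * (?C * (\<tau> powr r * V) / (2 ^ k * \<tau>) powr r)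
        = 4 * ?C * \<tau> * V * (2 powr (1 - r)) ^ k"
      using \<tau> by simp
    have "ennreal (4 * (2 ^ k * \<tau>)) * emeasure lebesgue (U k)
        \<le> ennreal (4 * (2 ^ k * \<tau>)) * ennreal (?C * (\<tau> powr r * V) / (2 ^ k * \<tau>) powr r)"
      by (intro mult_left_mono small) simp
    also have "\<dots> = ennreal (4 * ?C * \<tau> * V * (2 powr (1 - r)) ^ k)"
      unfolding eq[symmetric] using C V \<tau> by (intro ennreal_mult[symmetric]) auto
    finally show ?thesis .
  qed
  have "(\<Sum>k. ennreal (4 * (2 ^ k * \<tau>)) * emeasure lebesgue (U k))
      \<le> (\<Sum>k. ennreal (4 * ?C * \<tau> * V * (2 powr (1 - r)) ^ k))"
    using U_le by (intro suminf_le) auto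
  also have "\<dots> = ennreal (4 * ?C * \<tau> * V * (1 / (1 - 2 powr (1 - r))))"
  proof (rule suminf_ennreal_eq)
    have "norm (2 powr (1 - r)) < 1"
      using r powr_less_mono[of "1 - r" 0 2] by simp
    then show "(\<lambda>k. 4 * ?C * \<tau> * V * (2 powr (1 - r)) ^ k) sums (4 * ?C * \<tau> * V * (1 / (1 - 2 powr (1 - r))))"
      by (intro sums_mult geometric_sums)
  qed (use C \<tau> V in auto)
  also have "\<dots> \<le> ennreal (4 * ?C * \<tau> * V * (2 * (r / (r - 1))))"
  proof (intro ennreal_leI mult_left_mono)
    have "1 + 1 / (r - 1) = r / (r - 1)" using r by (simp add: field_simps)
    then show "1 / (1 - 2 powr (1 - r)) \<le> 2 * (r / (r - 1))"
      using geometric_bound[of "r - 1"] r by simp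
  qed (use C \<tau> V in auto)
  finally have series: "(\<Sum>k. ennreal (4 * (2 ^ k * \<tau>)) * emeasure lebesgue (U k))
      \<le> ennreal (4 * ?C * \<tau> * V * (2 * (r / (r - 1))))" .
  have "(\<integral>\<^sup>+x\<in>Q. maxfun f x \<partial>lebesgue) \<le>
      (\<integral>\<^sup>+x. ennreal (2 * \<tau>) * indicator Q x + (\<Sum>k. ennreal (4 * (2 ^ k * \<tau>)) * indicator (U k) x) \<partial>lebesgue)"
    using dom by (intro nn_integral_mono) (auto simp: indicator_def)
  also have "\<dots> = ennreal (2 * \<tau>) * emeasure lebesgue Q + (\<Sum>k. ennreal (4 * (2 ^ k * \<tau>)) * emeasure lebesgue (U k))"
    by (subst nn_integral_add, measurable, subst nn_integral_cmult_indicator, measurable,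
        subst nn_integral_suminf, measurable, subst nn_integral_cmult_indicator, measurable)
  also have "\<dots> \<le> ennreal (2 * \<tau>) * ennreal V + ennreal (4 * ?C * \<tau> * V * (2 * (r / (r - 1))))"
    unfolding eQ using series by (rule add_left_mono)
  also have "\<dots> = ennreal (2 * \<tau> * V + 4 * ?C * \<tau> * V * (2 * (r / (r - 1))))"
    using C \<tau> V r by (simp flip: ennreal_mult ennreal_plus)
  also have "\<dots> \<le> ennreal ((2 + 8 * ?C) * (r / (r - 1)) * \<tau> * V)"
  proof (rule ennreal_leI)
    have "2 * \<tau> * V * 1 \<le> 2 * \<tau> * V * (r / (r - 1))"
      using r \<tau> V by (intro mult_left_mono) (auto simp: field_simps)
    then show "2 * \<tau> * V + 4 * ?C * \<tau> * V * (2 * (r / (r - 1))) \<le> (2 + 8 * ?C) * (r / (r - 1)) * \<tau> * V"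
      by (simp add: algebra_simps)
  qed
  finally show ?thesis .
qed

section \<open>From the reverse Hoelder inequality to the A-infinity constant\<close>

lemma Ainf_le_of_reverse_holder:
  fixes w :: "'a::euclidean_space \<Rightarrow> real"
  assumes w: "weight w" and r: "1 < r"
    and rh: "\<And>Q. cube Q \<Longrightarrow> set_integrable lebesgue Q (\<lambda>x. w x powr r) \<and>
      (1 / measure lebesgue Q * (LINT x:Q|lebesgue. w x powr r)) powr (1 / r)
        \<le> K * (1 / measure lebesgue Q * (LINT x:Q|lebesgue. w x))"
  shows "Ainf w \<le> ennreal ((2 + 8 * vitali_const TYPE('a)) * K * (r / (r - 1)))"
  unfolding Ainf_def
proof (rule SUP_least)
  fix Q :: "'a set" assume "Q \<in> {Q. cube Q}"
  then have Q: "cube Q" by simp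
  then obtain a s where s: "s > 0" and Q_eq: "Q = cbox a (a + s *\<^sub>R One)"
    by (auto simp: cube_def)
  define V where "V = s ^ DIM('a)"
  have V: "0 < V" using s by (simp add: V_def)
  have mQ: "measure lebesgue Q = V" "emeasure lebesgue Q = ennreal V" "Q \<in> sets lebesgue"
    unfolding Q_eq V_def by (simp_all only: measure_cube[OF s] emeasure_cube[OF s]) simp
  note [measurable] = weight_measurable[OF w] mQ(3)
  define N where "N = mass w a s"
  have N: "0 < N" "(\<integral>\<^sup>+x\<in>Q. ennreal (w x) \<partial>lebesgue) = ennreal N" "(LINT x:Q|lebesgue. w x) = N"
    unfolding N_def Q_eq
    by (rule mass_pos[OF w s], simp only: nn_integral_hbox_cbox[symmetric] nn_integral_hbox_weight[OF w],
        rule mass_eq_cbox[OF w, symmetric])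
  define J where "J = (LINT x:Q|lebesgue. w x powr r)"
  have J_nn: "(\<integral>\<^sup>+x\<in>Q. ennreal (w x powr r) \<partial>lebesgue) = ennreal J"
    unfolding J_def using rh[OF Q] by (intro set_nn_integral_eq_set_integral) auto
  have "J > 0"
  proof (rule ccontr)
    assume "\<not> J > 0"
    then have "(\<integral>\<^sup>+x\<in>Q. ennreal (w x powr r) \<partial>lebesgue) = 0"
      unfolding J_nn by (simp add: ennreal_neg)
    then have "AE x in lebesgue. ennreal (w x powr r) * indicator Q x = 0"
      by (subst (asm) nn_integral_0_iff_AE) auto
    then have "AE x in lebesgue. ennreal (w x) * indicator Q x = 0"
      by eventually_elim (auto simp: indicator_def split: if_splits)
    then have "(\<integral>\<^sup>+x\<in>Q. ennreal (w x) \<partial>lebesgue) = 0"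
      by (subst nn_integral_0_iff_AE) auto
    with N show False by simp
  qed
  define \<tau> where "\<tau> = K * (N / V)"
  have le: "(J / V) powr (1 / r) \<le> \<tau>"
    using rh[OF Q] by (simp add: mQ N J_def \<tau>_def)
  \<comment> \<open>No sign is assumed for \<open>K\<close>: positivity of \<open>\<tau>\<close>
    follows from that of the left-hand side of the reverse Hoelder inequality.\<close>
  have "0 < (J / V) powr (1 / r)"
    using \<open>J > 0\<close> V by simp
  then have \<tau>: "0 < \<tau>" "((J / V) powr (1 / r)) powr r \<le> \<tau> powr r"
    using le r by (auto intro!: powr_mono2 intro: less_le_trans simp del: powr_gt_zero)
  then have J: "J \<le> \<tau> powr r * V"
    using r V \<open>J > 0\<close> by (simp add: powr_powr field_simps)
  let ?f = "\<lambda>y. w y * indicator Q y"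
  have "(\<integral>\<^sup>+x. ennreal (?f x powr r) \<partial>lebesgue) = (\<integral>\<^sup>+x\<in>Q. ennreal (w x powr r) \<partial>lebesgue)"
    by (intro nn_integral_cong) (auto simp: indicator_def)
  also have "\<dots> \<le> ennreal (\<tau> powr r * V)"
    unfolding J_nn using J by (rule ennreal_leI)
  finally have "(\<integral>\<^sup>+x\<in>Q. maxfun ?f x \<partial>lebesgue)
      \<le> ennreal ((2 + 8 * vitali_const TYPE('a)) * (r / (r - 1)) * \<tau> * V)"
    using r \<tau>(1) V mQ weight_nonneg[OF w] by (intro nn_integral_maxfun_le) auto
  also have "(2 + 8 * vitali_const TYPE('a)) * (r / (r - 1)) * \<tau> * V
      = N * ((2 + 8 * vitali_const TYPE('a)) * K * (r / (r - 1)))"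
    using V by (simp add: \<tau>_def)
  also have "ennreal \<dots> = ennreal N * ennreal ((2 + 8 * vitali_const TYPE('a)) * K * (r / (r - 1)))"
    using N(1) by (intro ennreal_mult') simp
  finally show "(\<integral>\<^sup>+x\<in>Q. maxfun ?f x \<partial>lebesgue) / (\<integral>\<^sup>+x\<in>Q. ennreal (w x) \<partial>lebesgue)
      \<le> ennreal ((2 + 8 * vitali_const TYPE('a)) * K * (r / (r - 1)))"
    unfolding N(2) using N(1) by (intro divide_le_posI_ennreal) simp_all
qed

theorem theorem2p3:
  shows "(\<forall>w :: 'a::euclidean_space \<Rightarrow> real. weight w \<and> Ainf w < \<infinity> \<longrightarrow>
          (let r = 1 + 1 / (2 ^ (11 + DIM('a)) * enn2real (Ainf w)) in
           \<forall>Q. cube Q \<longrightarrow>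
             set_integrable lebesgue Q (\<lambda>x. w x powr r) \<and>
             (1 / measure lebesgue Q * (LINT x:Q|lebesgue. w x powr r)) powr (1 / r)
               \<le> 2 * (1 / measure lebesgue Q * (LINT x:Q|lebesgue. w x))))
       \<and> (\<exists>c > 0. \<forall>(w :: 'a \<Rightarrow> real) (K::real) (r::real).
            weight w \<and> r > 1 \<and>
            (\<forall>Q. cube Q \<longrightarrow>
               set_integrable lebesgue Q (\<lambda>x. w x powr r) \<and>
               (1 / measure lebesgue Q * (LINT x:Q|lebesgue. w x powr r)) powr (1 / r)
                 \<le> K * (1 / measure lebesgue Q * (LINT x:Q|lebesgue. w x)))
            \<longrightarrow> Ainf w \<le> ennreal (c * K * (r / (r - 1))))"
proof (intro conjI)
  show "\<forall>w :: 'a \<Rightarrow> real. weight w \<and> Ainf w < \<infinity> \<longrightarrow>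
          (let r = 1 + 1 / (2 ^ (11 + DIM('a)) * enn2real (Ainf w)) in
           \<forall>Q. cube Q \<longrightarrow>
             set_integrable lebesgue Q (\<lambda>x. w x powr r) \<and>
             (1 / measure lebesgue Q * (LINT x:Q|lebesgue. w x powr r)) powr (1 / r)
               \<le> 2 * (1 / measure lebesgue Q * (LINT x:Q|lebesgue. w x)))"
    unfolding Let_def using reverse_holder by blast
  show "\<exists>c > 0. \<forall>(w :: 'a \<Rightarrow> real) (K::real) (r::real).
            weight w \<and> r > 1 \<and>
            (\<forall>Q. cube Q \<longrightarrow>
               set_integrable lebesgue Q (\<lambda>x. w x powr r) \<and>
               (1 / measure lebesgue Q * (LINT x:Q|lebesgue. w x powr r)) powr (1 / r)
                 \<le> K * (1 / measure lebesgue Q * (LINT x:Q|lebesgue. w x)))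
            \<longrightarrow> Ainf w \<le> ennreal (c * K * (r / (r - 1)))"
  proof (intro exI conjI allI impI)
    show "0 < 2 + 8 * vitali_const TYPE('a)"
      using vitali_const_nonneg[where 'a = 'a] by simp
  qed (blast intro: Ainf_le_of_reverse_holder)
qed

end
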